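(* There exists a minimal flag type $T$ of degree $18$ such that \[P_T\setminus\big(P_{T(2,3,3)}\cup P_{T(3,2,3)}\cup P_{T(3,3,2)}\big)\neq\emptyset\] and $T$ has a corner $(i,j)$ with $T(i,j)>i+j$.
   Context: Let $[n]=\{0,\dots,n-1\}$. A flag type of degree $n$ is a function $T:[n]\times[n]\to[n]$ such that $T(i,j)=T(j,i)$, $T(i,0)=i$, and $T(i,j)\le T(i+1,j)$ for $i<n-1$. A flag of a finite abelian group $G$ of order $n$ (written multiplicatively) is a chain of subsets $\{1\}=F_0\subset\cdots\subset F_{n-1}=G$ with $|F_i|=i+1$; a flag of a degree $n$ field extension $L/K$ is a chain of $K$-subspaces $K=F_0\subset\cdots\subset F_{n-1}=L$ with $\dim_KF_i=i+1$. The flag type of a flag is $T_{\mathcal F}(i,j)=\min\{k: F_iF_j\subseteq F_k\}$, where $F_iF_j$ is the set of products (groups) or the $K$-span of products (fields). A flag type is realizable if it equals $T_{\mathcal F}$ for some such flag; partial order $T\le T'$ iff pointwise; a flag type is minimal if it is realizable and minimal among realizable flag types of its degree. $P_T$ is the set of $\mathbf x\in\mathbb R^{n-1}$ with $0\le x_1\le\cdots\le x_{n-1}$ and $x_{T(i,j)}\le x_i+x_j$ for all $1\le i,j<n$. For $0<i,j<n$, $(i,j)$ is a corner of $T$ if $T(i-1,j)<T(i,j)$ and $T(i,j-1)<T(i,j)$. For a tuple $(n_1,\dots,n_t)$ of integers $>1$ with product $n$, write $m\in[n]$ as $m=m_1+m_2n_1+\cdots+m_tn_1\cdots n_{t-1}$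 ($0\le m_s<n_s$), let $H=C_{n_1}\times\cdots\times C_{n_t}$, $e_s$ a generator of the $s$-th factor, $v_m=e_1^{m_1}\cdots e_t^{m_t}$, $F_m=\{v_0,\dots,v_m\}$; $T(n_1,\dots,n_t)$ is the flag type of this flag of $H$. *)

theory Defs
  imports Complex_Main "HOL-Algebra.Algebra"
begin

text \<open>
  The set \<open>[n]\<close> is \<open>{..<n}\<close>. Flag types of degree \<open>n\<close> are functions of type \<open>nat \<Rightarrow> nat \<Rightarrow> nat\<close> of
  which only the values on \<open>[n] \<times> [n]\<close> matter; accordingly equality and order of flag types are
  always taken on \<open>[n] \<times> [n]\<close>.
\<close>

definition flag_type :: "nat \<Rightarrow> (nat \<Rightarrow> nat \<Rightarrow> nat) \<Rightarrow> bool" where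
  "flag_type n T \<longleftrightarrow>
     (\<forall>i<n. \<forall>j<n. T i j < n) \<and>
     (\<forall>i<n. \<forall>j<n. T i j = T j i) \<and>
     (\<forall>i<n. T i 0 = i) \<and>
     (\<forall>i j. i < n - 1 \<longrightarrow> j < n \<longrightarrow> T i j \<le> T (i + 1) j)"

definition flag_type_eq :: "nat \<Rightarrow> (nat \<Rightarrow> nat \<Rightarrow> nat) \<Rightarrow> (nat \<Rightarrow> nat \<Rightarrow> nat) \<Rightarrow> bool" where
  "flag_type_eq n T T' \<longleftrightarrow> (\<forall>i<n. \<forall>j<n. T i j = T' i j)"

definition flag_type_le :: "nat \<Rightarrow> (nat \<Rightarrow> nat \<Rightarrow> nat) \<Rightarrow> (nat \<Rightarrow> nat \<Rightarrow> nat) \<Rightarrow> bool" where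
  "flag_type_le n T T' \<longleftrightarrow> (\<forall>i<n. \<forall>j<n. T i j \<le> T' i j)"

definition group_flag :: "nat \<Rightarrow> ('a, 'b) monoid_scheme \<Rightarrow> (nat \<Rightarrow> 'a set) \<Rightarrow> bool" where
  "group_flag n G F \<longleftrightarrow>
     F 0 = {\<one>\<^bsub>G\<^esub>} \<and> F (n - 1) = carrier G \<and>
     (\<forall>i < n - 1. F i \<subset> F (i + 1)) \<and>
     (\<forall>i < n. card (F i) = i + 1)"

definition group_flag_type :: "('a, 'b) monoid_scheme \<Rightarrow> (nat \<Rightarrow> 'a set) \<Rightarrow> nat \<Rightarrow> nat \<Rightarrow> nat" where
  "group_flag_type G F i j = (LEAST k. F i <#>\<^bsub>G\<^esub> F j \<subseteq> F k)"

text \<open>In HOL-Algebra, \<open>subalgebra K V L\<close> says that \<open>V\<close> is a \<open>K\<close>-subspace of \<open>L\<close> (closure under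
  multiplication of \<open>V\<close> is not required), and \<open>ring.dimension L d K V\<close> says that \<open>V\<close> has dimension
  \<open>d\<close> over \<open>K\<close>.\<close>

definition field_flag :: "nat \<Rightarrow> 'a set \<Rightarrow> ('a, 'b) ring_scheme \<Rightarrow> (nat \<Rightarrow> 'a set) \<Rightarrow> bool" where
  "field_flag n K L F \<longleftrightarrow>
     F 0 = K \<and> F (n - 1) = carrier L \<and>
     (\<forall>i < n - 1. F i \<subset> F (i + 1)) \<and>
     (\<forall>i < n. subalgebra K (F i) L \<and> ring.dimension L (i + 1) K (F i))"

definition span_products :: "'a set \<Rightarrow> ('a, 'b) ring_scheme \<Rightarrow> 'a set \<Rightarrow> 'a set \<Rightarrow> 'a set" where
  "span_products K L A B = (\<lambda>V. subalgebra K V L) hull (A <#>\<^bsub>L\<^esub> B)"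

definition field_flag_type ::
    "'a set \<Rightarrow> ('a, 'b) ring_scheme \<Rightarrow> (nat \<Rightarrow> 'a set) \<Rightarrow> nat \<Rightarrow> nat \<Rightarrow> nat" where
  "field_flag_type K L F i j = (LEAST k. span_products K L (F i) (F j) \<subseteq> F k)"

text \<open>Realizability by a group or a field extension whose elements have type \<open>'a\<close>.\<close>

definition realizable_in :: "'a itself \<Rightarrow> nat \<Rightarrow> (nat \<Rightarrow> nat \<Rightarrow> nat) \<Rightarrow> bool" where
  "realizable_in TYPE('a) n T \<longleftrightarrow> flag_type n T \<and>
     ((\<exists>(G :: 'a monoid) F. comm_group G \<and> finite (carrier G) \<and> order G = n \<and>
         group_flag n G F \<and> flag_type_eq n T (group_flag_type G F)) \<or>
      (\<exists>(L :: 'a ring) K F. field L \<and> subfield K L \<and> ring.dimension L n K (carrier L) \<and>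
         field_flag n K L F \<and> flag_type_eq n T (field_flag_type K L F)))"

text \<open>HOL cannot quantify over all carrier types inside a formula. Nothing is lost by using carriers
  of type \<^typ>\<open>nat\<close>: the lemma \<open>realizable_in_imp_realizable\<close> below shows that a flag type that is
  realizable over any type whatsoever is already realizable over \<^typ>\<open>nat\<close>. (For a field extension
  \<open>L/K\<close> one passes to a suitable countable subfield of \<open>L\<close>.)\<close>

definition realizable :: "nat \<Rightarrow> (nat \<Rightarrow> nat \<Rightarrow> nat) \<Rightarrow> bool" where
  "realizable n T \<longleftrightarrow> realizable_in TYPE(nat) n T"

definition minimal_flag_type :: "nat \<Rightarrow> (nat \<Rightarrow> nat \<Rightarrow> nat) \<Rightarrow> bool" where
  "minimal_flag_type n T \<longleftrightarrow> realizable n T \<and>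
     (\<forall>T'. realizable n T' \<longrightarrow> flag_type_le n T' T \<longrightarrow> flag_type_eq n T' T)"

text \<open>Points of \<open>\<real>\<^sup>n\<^sup>-\<^sup>1\<close> are functions on the index set \<open>{1,\<dots>,n-1}\<close>, extended by \<^const>\<open>undefined\<close>.\<close>

definition flag_polytope :: "nat \<Rightarrow> (nat \<Rightarrow> nat \<Rightarrow> nat) \<Rightarrow> (nat \<Rightarrow> real) set" where
  "flag_polytope n T = {x \<in> {1..<n} \<rightarrow>\<^sub>E (UNIV :: real set).
     (\<forall>i\<in>{1..<n}. 0 \<le> x i) \<and>
     (\<forall>i\<in>{1..<n}. \<forall>j\<in>{1..<n}. i \<le> j \<longrightarrow> x i \<le> x j) \<and>
     (\<forall>i\<in>{1..<n}. \<forall>j\<in>{1..<n}. x (T i j) \<le> x i + x j)}"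

definition corner :: "nat \<Rightarrow> (nat \<Rightarrow> nat \<Rightarrow> nat) \<Rightarrow> nat \<Rightarrow> nat \<Rightarrow> bool" where
  "corner n T i j \<longleftrightarrow> 0 < i \<and> i < n \<and> 0 < j \<and> j < n \<and>
     T (i - 1) j < T i j \<and> T i (j - 1) < T i j"

text \<open>A tuple \<open>(n\<^sub>1,\<dots>,n\<^sub>t)\<close> is a list \<open>ns\<close>, with factors indexed from \<open>0\<close>. The digits below are those
  of \<open>m = m\<^sub>1 + m\<^sub>2 n\<^sub>1 + \<dots> + m\<^sub>t n\<^sub>1\<cdots>n\<^sub>t\<^sub>-\<^sub>1\<close>.\<close>

definition mixed_radix_digit :: "nat list \<Rightarrow> nat \<Rightarrow> nat \<Rightarrow> nat" where
  "mixed_radix_digit ns m s = (m div (\<Prod>r<s. ns ! r)) mod (ns ! s)"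

definition tuple_group :: "nat list \<Rightarrow> (nat \<Rightarrow> int) monoid" where
  "tuple_group ns = product_group {..<length ns} (\<lambda>s. integer_mod_group (ns ! s))"

text \<open>\<^const>\<open>integer_mod_group\<close> is additive modulo \<open>n\<^sub>s\<close> with generator \<open>1\<close>, so the \<open>s\<close>-th component
  of \<open>e\<^sub>1\<^bsup>m\<^sub>1\<^esup>\<cdots>e\<^sub>t\<^bsup>m\<^sub>t\<^esup>\<close> is the \<open>m\<^sub>s\<close>-th power of \<open>1\<close>.\<close>

definition tuple_element :: "nat list \<Rightarrow> nat \<Rightarrow> nat \<Rightarrow> int" where
  "tuple_element ns m =
     (\<lambda>s\<in>{..<length ns}. 1 [^]\<^bsub>integer_mod_group (ns ! s)\<^esub> mixed_radix_digit ns m s)"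

definition tuple_flag :: "nat list \<Rightarrow> nat \<Rightarrow> (nat \<Rightarrow> int) set" where
  "tuple_flag ns m = tuple_element ns ` {..m}"

definition tuple_flag_type :: "nat list \<Rightarrow> nat \<Rightarrow> nat \<Rightarrow> nat" where
  "tuple_flag_type ns = group_flag_type (tuple_group ns) (tuple_flag ns)"

lemma LEAST_bounded_cong:
  fixes P Q :: "nat \<Rightarrow> bool"
  assumes "\<And>k. k < n \<Longrightarrow> P k \<longleftrightarrow> Q k" and "P (n - 1)" and "0 < n"
  shows "(LEAST k. P k) = (LEAST k. Q k)"
proof -
  have P: "P (LEAST k. P k)" and le: "(LEAST k. P k) \<le> n - 1"
    using assms(2) by (auto intro: LeastI Least_le)
  show ?thesis
  proof (rule Least_equality[symmetric])
    show "Q (LEAST k. P k)"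
      using P le assms(1)[of "LEAST k. P k"] assms(3) by simp
    show "(LEAST k. P k) \<le> y" if "Q y" for y
    proof (rule ccontr)
      assume "\<not> (LEAST k. P k) \<le> y"
      then have "y < (LEAST k. P k)" by simp
      moreover from this have "P y"
        using le assms(1)[of y] assms(3) that by simp
      ultimately show False
        using not_less_Least by blast
    qed
  qed
qed

lemma group_flag_subset_carrier:
  assumes "group_flag n G F" and "i < n"
  shows "F i \<subseteq> carrier G"
proof -
  have "i \<le> n - 1" using assms(2) by simp
  then have "F i \<subseteq> F (n - 1)"
  proof (induction rule: inc_induct)
    case (step m)
    then show ?case using assms(1) unfolding group_flag_def by force
  qed simp
  then show ?thesis using assms(1) by (simp add: group_flag_def)
qed

lemma field_flag_subset_carrier:
  assumes "field_flag n K L F" and "i < n"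
  shows "F i \<subseteq> carrier L"
proof -
  have "subalgebra K (F i) L" using assms by (simp add: field_flag_def)
  from subgroup.subset[OF subalgebra.axioms(1)[OF this]] show ?thesis by simp
qed

lemma field_flag_type_eq_LEAST:
  assumes "field_flag n K L F" and "i < n" and "j < n" and "monoid L"
  shows "field_flag_type K L F i j = (LEAST k. F i <#>\<^bsub>L\<^esub> F j \<subseteq> F k)"
  unfolding field_flag_type_def
proof (rule LEAST_bounded_cong)
  show "span_products K L (F i) (F j) \<subseteq> F k \<longleftrightarrow> F i <#>\<^bsub>L\<^esub> F j \<subseteq> F k" if "k < n" for k
  proof -
    have "subalgebra K (F k) L" using assms(1) that by (simp add: field_flag_def)
    then show ?thesis unfolding span_products_def
      by (meson hull_minimal hull_subset subset_trans)
  qed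
  have "F i <#>\<^bsub>L\<^esub> F j \<subseteq> F (n - 1)"
    using field_flag_subset_carrier[OF assms(1,2)] field_flag_subset_carrier[OF assms(1,3)] assms(1,4)
    unfolding field_flag_def set_mult_def by (auto intro: monoid.m_closed)
  moreover have "n - 1 < n" using assms(2) by simp
  then have "subalgebra K (F (n - 1)) L" using assms(1) unfolding field_flag_def by blast
  ultimately show "span_products K L (F i) (F j) \<subseteq> F (n - 1)" unfolding span_products_def
      by (meson hull_minimal)
qed (use assms(2) in simp)

lemma image_set_mult:
  assumes "A \<subseteq> carrier G" and "B \<subseteq> carrier G"
    and "\<And>x y. x \<in> carrier G \<Longrightarrow> y \<in> carrier G \<Longrightarrow> f x \<otimes>\<^bsub>H\<^esub> f y = f (x \<otimes>\<^bsub>G\<^esub> y)"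
  shows "f ` A <#>\<^bsub>H\<^esub> f ` B = f ` (A <#>\<^bsub>G\<^esub> B)"
proof -
  have h: "f a \<otimes>\<^bsub>H\<^esub> f b = f (a \<otimes>\<^bsub>G\<^esub> b)" if "a \<in> A" "b \<in> B" for a b
    using assms that by blast
  have "f ` A <#>\<^bsub>H\<^esub> f ` B = (\<Union>a\<in>A. \<Union>b\<in>B. {f a \<otimes>\<^bsub>H\<^esub> f b})"
    unfolding set_mult_def by blast
  also have "\<dots> = (\<Union>a\<in>A. \<Union>b\<in>B. {f (a \<otimes>\<^bsub>G\<^esub> b)})"
    using h by simp
  also have "\<dots> = f ` (A <#>\<^bsub>G\<^esub> B)"
    unfolding set_mult_def by blast
  finally show ?thesis .
qed

lemma image_subset_iff_of_inj:
  assumes "inj_on f C" "A \<subseteq> C" "B \<subseteq> C"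
  shows "f ` A \<subseteq> f ` B \<longleftrightarrow> A \<subseteq> B"
proof
  assume sub: "f ` A \<subseteq> f ` B"
  show "A \<subseteq> B"
  proof
    fix x assume x: "x \<in> A"
    then obtain y where y: "y \<in> B" "f x = f y" using sub by blast
    with x assms(2,3) have "x = y" by (intro inj_onD[OF assms(1)]) auto
    with y show "x \<in> B" by simp
  qed
qed blast

lemma realizable_group:
  fixes G :: "'a monoid"
  assumes "comm_group G" "finite (carrier G)" "order G = n" "group_flag n G F"
  shows "\<exists>(G' :: nat monoid) F'. comm_group G' \<and> finite (carrier G') \<and> order G' = n \<and>
    group_flag n G' F' \<and> flag_type_eq n (group_flag_type G F) (group_flag_type G' F')"
proof -
  interpret comm_group G by fact
  obtain f :: "'a \<Rightarrow> nat" where f: "inj_on f (carrier G)"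
    using finite_imp_inj_to_nat_seg[OF assms(2)] by blast
  define G' where "G' = image_group f G"
  define F' where "F' i = f ` F i" for i
  have iso: "f \<in> iso G G'"
    unfolding G'_def by (rule inj_imp_image_group_iso[OF f])
  have carr: "carrier G' = f ` carrier G" and one: "\<one>\<^bsub>G'\<^esub> = f \<one>\<^bsub>G\<^esub>"
    by (simp_all add: G'_def image_group_def)
  have "group G'"
    unfolding G'_def by (rule inj_imp_image_group_is_group[OF f])
  then have "monoid G'" by (rule group.is_monoid)
  then have cg: "comm_group G'"
    using iso_imp_comm_group[of G'] iso unfolding is_iso_def by blast
  have sub: "F i \<subseteq> carrier G" if "i < n" for i
    using group_flag_subset_carrier[OF assms(4) that] .
  have n0: "0 < n"
    using assms(2,3) order_gt_0_iff_finite by simp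
  have inj: "inj_on f (F i)" if "i < n" for i
    using sub[OF that] f inj_on_subset by blast
  have fin: "finite (carrier G')" using assms(2) carr by simp
  have ord: "order G' = n" using assms(3) f carr by (simp add: order_def card_image)
  have flag: "group_flag n G' F'"
    unfolding group_flag_def
  proof (intro conjI allI impI)
    show "F' 0 = {\<one>\<^bsub>G'\<^esub>}" "F' (n - 1) = carrier G'"
      using assms(4) by (simp_all add: F'_def group_flag_def one carr)
    show "card (F' i) = i + 1" if "i < n" for i
      using assms(4) that inj[OF that] by (simp add: F'_def group_flag_def card_image)
    show "F' i \<subset> F' (i + 1)" if "i < n - 1" for i
    proof -
      have "F i \<subset> F (i + 1)" using assms(4) that by (simp add: group_flag_def)
      moreover have "inj_on f (F (i + 1))" using inj[of "i + 1"] that by simp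
      ultimately show ?thesis unfolding F'_def by (simp add: image_strict_mono)
    qed
  qed
  have "group_flag_type G F i j = group_flag_type G' F' i j" if ij: "i < n" "j < n" for i j
    unfolding group_flag_type_def
  proof (rule LEAST_bounded_cong)
    have prod: "F' i <#>\<^bsub>G'\<^esub> F' j = f ` (F i <#>\<^bsub>G\<^esub> F j)"
      unfolding F'_def
      by (rule image_set_mult[OF sub[OF ij(1)] sub[OF ij(2)]])
        (use iso in \<open>simp add: iso_def hom_def\<close>)
    have subp: "F i <#>\<^bsub>G\<^esub> F j \<subseteq> carrier G"
      using sub[OF ij(1)] sub[OF ij(2)] by (rule set_mult_closed)
    show "F i <#>\<^bsub>G\<^esub> F j \<subseteq> F k \<longleftrightarrow> F' i <#>\<^bsub>G'\<^esub> F' j \<subseteq> F' k" if "k < n" for k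
      unfolding prod unfolding F'_def
      using image_subset_iff_of_inj[OF f subp sub[OF that]] by simp
    show "F i <#>\<^bsub>G\<^esub> F j \<subseteq> F (n - 1)"
      using subp assms(4) by (simp add: group_flag_def)
  qed (rule n0)
  then have "flag_type_eq n (group_flag_type G F) (group_flag_type G' F')"
    by (simp add: flag_type_eq_def)
  with cg fin ord flag show ?thesis by blast
qed

lemma countable_closure:
  fixes S C :: "'a set" and Ops :: "('a \<Rightarrow> 'a \<Rightarrow> 'a) set"
  assumes "countable S" "countable Ops" "S \<subseteq> C"
    and "\<And>f x y. f \<in> Ops \<Longrightarrow> x \<in> C \<Longrightarrow> y \<in> C \<Longrightarrow> f x y \<in> C"
  obtains M where "countable M" "S \<subseteq> M" "M \<subseteq> C"
    "\<And>f x y. f \<in> Ops \<Longrightarrow> x \<in> M \<Longrightarrow> y \<in> M \<Longrightarrow> f x y \<in> M"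
proof -
  define step where "step A = A \<union> (\<Union>f\<in>Ops. (\<lambda>(x, y). f x y) ` (A \<times> A))" for A
  define A where "A m = (step ^^ m) S" for m
  have A0: "A 0 = S" and ASuc: "A (Suc m) = step (A m)" for m
    by (simp_all add: A_def)
  have cnt: "countable (A m)" for m
    by (induction m) (use assms(1,2) in \<open>auto simp: A0 ASuc step_def\<close>)
  have subC: "A m \<subseteq> C" for m
  proof (induction m)
    case (Suc m)
    then have "f x y \<in> C" if "f \<in> Ops" "x \<in> A m" "y \<in> A m" for f x y
      using assms(4) that by blast
    then show ?case using Suc by (auto simp: ASuc step_def)
  qed (simp add: A0 assms(3))
  have "A m \<subseteq> A (Suc m)" for m by (auto simp: ASuc step_def)
  then have mono: "A m \<subseteq> A m'" if "m \<le> m'" for m m'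
    using that lift_Suc_mono_le[of A] by blast
  show thesis
  proof (rule that[of "\<Union>m. A m"])
    show "countable (\<Union>m. A m)" using cnt by simp
    show "S \<subseteq> (\<Union>m. A m)" using A0 by blast
    show "(\<Union>m. A m) \<subseteq> C" using subC by blast
    fix f x y assume f: "f \<in> Ops" and "x \<in> (\<Union>m. A m)" "y \<in> (\<Union>m. A m)"
    then obtain p q where "x \<in> A p" "y \<in> A q" by blast
    then have "x \<in> A (max p q)" "y \<in> A (max p q)"
      using mono[of p "max p q"] mono[of q "max p q"] by auto
    then have "f x y \<in> A (Suc (max p q))" using f by (auto simp: ASuc step_def)
    then show "f x y \<in> (\<Union>m. A m)" by blast
  qed
qed

lemma realizable_field:
  fixes L :: "'a ring"
  assumes "field L" "subfield K L" "ring.dimension L n K (carrier L)" "field_flag n K L F"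
  shows "\<exists>(L' :: nat ring) K' F'. field L' \<and> subfield K' L' \<and>
    ring.dimension L' n K' (carrier L') \<and> field_flag n K' L' F' \<and>
    flag_type_eq n (field_flag_type K L F) (field_flag_type K' L' F')"
proof -
  interpret L: field L by fact
  have n0: "0 < n"
  proof (rule ccontr)
    assume "\<not> 0 < n"
    then have "carrier L = {\<zero>\<^bsub>L\<^esub>}" using assms(3) L.dimension_zero[OF assms(2)] by simp
    then show False using L.one_closed L.one_not_zero by auto
  qed
  have KL: "K \<subseteq> carrier L" by (rule subfieldE(3)[OF assms(2)])
  have sub: "F i \<subseteq> carrier L" if "i < n" for i
    using field_flag_subset_carrier[OF assms(4) that] .
  have alg: "subalgebra K (F i) L" and dim: "L.dimension (Suc i) K (F i)" if "i < n" for i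
    using assms(4) that by (simp_all add: field_flag_def)
  have F0: "F 0 = K" and Fn: "F (n - 1) = carrier L" and
    Finc: "\<And>i. Suc i < n \<Longrightarrow> F i \<subset> F (Suc i)"
    using assms(4) by (auto simp: field_flag_def)
  have addF: "x \<oplus>\<^bsub>L\<^esub> y \<in> F i" if "i < n" "x \<in> F i" "y \<in> F i" for i x y
    using subgroup.m_closed[OF subalgebra.axioms(1)[OF alg[OF that(1)]]] that by simp
  have ex_b: "\<exists>b. b \<in> F (Suc i) \<and> b \<notin> F i \<and> F (Suc i) = L.line_extension K b (F i)"
    if i: "Suc i < n" for i
  proof -
    obtain b where b: "b \<in> F (Suc i)" "b \<notin> F i" using Finc[OF i] by blast
    have bc: "b \<in> carrier L" using b sub[OF i] by blast
    have sub1: "L.line_extension K b (F i) \<subseteq> F (Suc i)"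
    proof
      fix u assume "u \<in> L.line_extension K b (F i)"
      then obtain k v where "k \<in> K" "v \<in> F i" "u = k \<otimes>\<^bsub>L\<^esub> b \<oplus>\<^bsub>L\<^esub> v"
        using L.line_extension_mem_iff by blast
      then show "u \<in> F (Suc i)"
        using Finc[OF i] subalgebra.smult_closed[OF alg[OF i]] b(1) addF[OF i] by blast
    qed
    have d: "L.dimension (Suc (Suc i)) K (L.line_extension K b (F i))"
      using L.Suc_dim[OF bc b(2)] dim[of i] i by simp
    obtain Us where Us: "set Us \<subseteq> carrier L" "L.independent K Us" "length Us = Suc (Suc i)"
        "L.Span K Us = L.line_extension K b (F i)"
      using L.exists_base[OF assms(2) d] by blast
    have "set Us \<subseteq> F (Suc i)"
      using sub1 L.Span_base_incl[OF assms(2) Us(1)] Us(4) by blast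
    then have "L.Span K Us = F (Suc i)"
      using L.independent_length_eq_dimension[OF assms(2) dim[OF i] Us(2)] Us(3) by simp
    then show ?thesis using b Us(4) by blast
  qed
  define b where "b i = (SOME b. b \<in> F (Suc i) \<and> b \<notin> F i \<and>
    F (Suc i) = L.line_extension K b (F i))" for i
  have b: "b i \<in> F (Suc i)" "b i \<notin> F i" "F (Suc i) = L.line_extension K (b i) (F i)"
    if "Suc i < n" for i
    using someI_ex[OF ex_b[OF that]] unfolding b_def by blast+
  have "\<exists>p. \<forall>x. Suc i < n \<longrightarrow> x \<in> F (Suc i) \<longrightarrow>
      fst (p x) \<in> K \<and> snd (p x) \<in> F i \<and> x = fst (p x) \<otimes>\<^bsub>L\<^esub> b i \<oplus>\<^bsub>L\<^esub> snd (p x)" for i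
  proof -
    have "\<exists>q. Suc i < n \<longrightarrow> x \<in> F (Suc i) \<longrightarrow>
      fst q \<in> K \<and> snd q \<in> F i \<and> x = fst q \<otimes>\<^bsub>L\<^esub> b i \<oplus>\<^bsub>L\<^esub> snd q" for x
      using b(3)[of i] L.line_extension_mem_iff[of x K "b i" "F i"] by fastforce
    then show ?thesis by metis
  qed
  then obtain p where p: "\<And>i x. Suc i < n \<Longrightarrow> x \<in> F (Suc i) \<Longrightarrow>
      fst (p i x) \<in> K \<and> snd (p i x) \<in> F i \<and> x = fst (p i x) \<otimes>\<^bsub>L\<^esub> b i \<oplus>\<^bsub>L\<^esub> snd (p i x)"
    by metis
  define wit where "wit i j k = (SOME w. fst w \<in> F i \<and> snd w \<in> F j \<and> fst w \<otimes>\<^bsub>L\<^esub> snd w \<notin> F k)"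
    for i j k
  have wit: "fst (wit i j k) \<in> F i \<and> snd (wit i j k) \<in> F j \<and>
      fst (wit i j k) \<otimes>\<^bsub>L\<^esub> snd (wit i j k) \<notin> F k"
    if "\<not> F i <#>\<^bsub>L\<^esub> F j \<subseteq> F k" for i j k
  proof -
    have "\<exists>w. fst w \<in> F i \<and> snd w \<in> F j \<and> fst w \<otimes>\<^bsub>L\<^esub> snd w \<notin> F k"
      using that unfolding set_mult_def by fastforce
    then show ?thesis unfolding wit_def by (rule someI_ex)
  qed
  define S where "S = ({\<zero>\<^bsub>L\<^esub>, \<one>\<^bsub>L\<^esub>} \<union> range b \<union>
    (\<Union>i j k. {fst (wit i j k), snd (wit i j k)})) \<inter> carrier L"
  define Ops where "Ops = {\<lambda>x y. x \<oplus>\<^bsub>L\<^esub> y, \<lambda>x y. x \<otimes>\<^bsub>L\<^esub> y, \<lambda>x y. \<ominus>\<^bsub>L\<^esub> x,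
      \<lambda>x y. if x = \<zero>\<^bsub>L\<^esub> then x else inv\<^bsub>L\<^esub> x} \<union>
    range (\<lambda>i x y. if Suc i < n \<and> x \<in> F (Suc i) then fst (p i x) else x) \<union>
    range (\<lambda>i x y. if Suc i < n \<and> x \<in> F (Suc i) then snd (p i x) else x)"
  have "countable S" unfolding S_def by (intro countable_Int1) auto
  moreover have "countable Ops" unfolding Ops_def by auto
  moreover have "S \<subseteq> carrier L" unfolding S_def by blast
  moreover have "f x y \<in> carrier L" if "f \<in> Ops" "x \<in> carrier L" "y \<in> carrier L" for f x y
  proof -
    have "fst (p i x) \<in> carrier L \<and> snd (p i x) \<in> carrier L" if "Suc i < n" "x \<in> F (Suc i)" for i
      using p[OF that] KL sub[of i] that(1) by (meson Suc_lessD subsetD)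
    with that show ?thesis unfolding Ops_def by (auto simp: L.field_Units)
  qed
  ultimately obtain M where M: "countable M" "S \<subseteq> M" "M \<subseteq> carrier L"
    and Mops: "\<And>f x y. f \<in> Ops \<Longrightarrow> x \<in> M \<Longrightarrow> y \<in> M \<Longrightarrow> f x y \<in> M"
    using countable_closure[of S Ops "carrier L"] by metis
  have M0: "\<zero>\<^bsub>L\<^esub> \<in> M" and M1: "\<one>\<^bsub>L\<^esub> \<in> M" using M(2) by (auto simp: S_def)
  have Madd: "x \<oplus>\<^bsub>L\<^esub> y \<in> M" if "x \<in> M" "y \<in> M" for x y
    using Mops[of "\<lambda>x y. x \<oplus>\<^bsub>L\<^esub> y" x y] that by (simp add: Ops_def)
  have Mmul: "x \<otimes>\<^bsub>L\<^esub> y \<in> M" if "x \<in> M" "y \<in> M" for x y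
    using Mops[of "\<lambda>x y. x \<otimes>\<^bsub>L\<^esub> y" x y] that by (simp add: Ops_def)
  have Mneg: "\<ominus>\<^bsub>L\<^esub> x \<in> M" if "x \<in> M" for x
    using Mops[of "\<lambda>x y. \<ominus>\<^bsub>L\<^esub> x" x x] that by (simp add: Ops_def)
  have Minv: "inv\<^bsub>L\<^esub> x \<in> M" if "x \<in> M" "x \<noteq> \<zero>\<^bsub>L\<^esub>" for x
    using Mops[of "\<lambda>x y. if x = \<zero>\<^bsub>L\<^esub> then x else inv\<^bsub>L\<^esub> x" x x] that by (simp add: Ops_def)
  have Mp: "fst (p i x) \<in> M" "snd (p i x) \<in> M" if "Suc i < n" "x \<in> F (Suc i)" "x \<in> M" for i x
  proof -
    have "(\<lambda>x y. if Suc i < n \<and> x \<in> F (Suc i) then fst (p i x) else x) \<in> Ops"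
      "(\<lambda>x y. if Suc i < n \<and> x \<in> F (Suc i) then snd (p i x) else x) \<in> Ops"
      unfolding Ops_def by blast+
    from Mops[OF this(1) that(3,3)] Mops[OF this(2) that(3,3)]
    show "fst (p i x) \<in> M" "snd (p i x) \<in> M" using that by simp_all
  qed
  have Mb: "b i \<in> M" if "Suc i < n" for i
  proof -
    have "b i \<in> S" unfolding S_def using b(1)[OF that] sub[OF that] by blast
    then show ?thesis using M(2) by blast
  qed
  have Msub: "subring M L"
    by (rule L.subringI) (use M(3) M1 Madd Mmul Mneg in auto)
  have Mfield: "subfield M L"
    by (rule L.subfieldI'[OF Msub]) (use Minv in auto)
  define L1 where "L1 = L\<lparr>carrier := M\<rparr>"
  define F1 where "F1 i = F i \<inter> M" for i
  define K1 where "K1 = K \<inter> M"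
  have L1: "field L1"
    unfolding L1_def by (rule L.subfield_iff(2)[OF Mfield])
  interpret L1: field L1 by (rule L1)
  note K = subringE[OF subfieldE(1)[OF assms(2)]]
  have "subring K1 L"
    unfolding K1_def by (rule L.subringI) (use K M(3) M1 Madd Mmul Mneg in auto)
  then have "subfield K1 L"
    using Minv L.subfield_m_inv(1)[OF assms(2)] by (intro L.subfieldI') (auto simp: K1_def)
  then have "field (L\<lparr>carrier := K1\<rparr>)" by (rule L.subfield_iff(2))
  then have K1: "subfield K1 L1"
    by (intro L1.subfield_iff(1)) (auto simp: L1_def K1_def)
  have ops: "x \<otimes>\<^bsub>L1\<^esub> y = x \<otimes>\<^bsub>L\<^esub> y" "x \<oplus>\<^bsub>L1\<^esub> y = x \<oplus>\<^bsub>L\<^esub> y" for x y by (simp_all add: L1_def)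
  have carr1: "carrier L1 = M" by (simp add: L1_def)
  have ext1: "F1 (Suc i) = L1.line_extension K1 (b i) (F1 i)" if i: "Suc i < n" for i
  proof (intro equalityI subsetI)
    fix x assume "x \<in> F1 (Suc i)"
    then have x: "x \<in> F (Suc i)" "x \<in> M" by (auto simp: F1_def)
    then show "x \<in> L1.line_extension K1 (b i) (F1 i)"
      using p[OF i x(1)] Mp[OF i x] unfolding L1.line_extension_mem_iff ops F1_def K1_def by blast
  next
    fix x assume "x \<in> L1.line_extension K1 (b i) (F1 i)"
    then obtain k v where kv: "k \<in> K" "k \<in> M" "v \<in> F i" "v \<in> M" "x = k \<otimes>\<^bsub>L\<^esub> b i \<oplus>\<^bsub>L\<^esub> v"
      unfolding L1.line_extension_mem_iff ops F1_def K1_def by blast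
    then have "x \<in> F (Suc i)" using b(3)[OF i] L.line_extension_mem_iff by blast
    moreover have "x \<in> M" using kv Madd Mmul Mb[OF i] by simp
    ultimately show "x \<in> F1 (Suc i)" by (simp add: F1_def)
  qed
  have dim1: "L1.dimension (Suc i) K1 (F1 i)" if "i < n" for i
    using that
  proof (induction i)
    case 0
    then show ?case using L1.dimension_one[OF K1] by (simp add: F1_def F0 K1_def)
  next
    case (Suc i)
    then have "L1.dimension (Suc i) K1 (F1 i)" by simp
    then show ?case
      using L1.Suc_dim[of "b i" "F1 i" "Suc i" K1] Mb[OF Suc.prems] b(2)[OF Suc.prems]
      by (simp add: ext1[OF Suc.prems] carr1 F1_def[of i])
  qed
  obtain f :: "'a \<Rightarrow> nat" where f: "inj_on f M" using M(1) countable_def by blast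
  then have f1: "inj_on f (carrier L1)" by (simp add: carr1)
  define L2 where "L2 = image_ring f L1"
  define F2 where "F2 i = f ` F1 i" for i
  define K2 where "K2 = f ` K1"
  have L2: "field L2" unfolding L2_def by (rule L1.inj_imp_image_ring_is_field[OF f1])
  interpret L2: field L2 by (rule L2)
  have fhom: "f \<in> ring_hom L1 L2"
    using inj_imp_image_ring_iso[OF f1] by (simp add: L2_def ring_iso_def)
  interpret h: ring_hom_ring L1 L2 f
    by (rule ring_hom_ringI2[OF L1.ring_axioms L2.ring_axioms fhom])
  have carr2: "carrier L2 = f ` M" by (simp add: L2_def image_ring_carrier carr1)
  have K2: "subfield K2 L2" unfolding K2_def by (rule h.img_is_subfield(2)[OF K1]) simp
  have sub1: "F1 i \<subseteq> M" for i by (simp add: F1_def)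
  have dim2: "L2.dimension (Suc i) K2 (F2 i)" if "i < n" for i
    unfolding K2_def F2_def
    by (rule h.inj_hom_dimension[OF K1 _ inj_on_subset[OF f sub1] dim1[OF that]]) simp
  have F1n: "F1 (n - 1) = M" unfolding F1_def Fn using M(3) by blast
  have flag2: "field_flag n K2 L2 F2"
    unfolding field_flag_def
  proof (intro conjI allI impI)
    show "F2 0 = K2" by (simp add: F2_def K2_def F1_def F0 K1_def)
    show "F2 (n - 1) = carrier L2" unfolding F2_def F1n carr2 by (rule refl)
    show "F2 i \<subset> F2 (i + 1)" if "i < n - 1" for i
    proof -
      have i: "Suc i < n" using that by simp
      have "F1 i \<subset> F1 (Suc i)"
        using Finc[OF i] b(1,2)[OF i] Mb[OF i] unfolding F1_def by blast
      then show ?thesis unfolding F2_def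
        using image_strict_mono[OF inj_on_subset[OF f sub1]] by simp
    qed
    show "L2.dimension (i + 1) K2 (F2 i)" if "i < n" for i
      using dim2[OF that] by simp
    then show "subalgebra K2 (F2 i) L2" if "i < n" for i
      using L2.finite_dimension_imp_subalgebra[OF K2 L2.finite_dimensionI] that by blast
  qed
  have dimL2: "L2.dimension n K2 (carrier L2)"
    using dim2[of "n - 1"] n0 unfolding F2_def F1n carr2 by simp
  have "field_flag_type K L F i j = field_flag_type K2 L2 F2 i j" if ij: "i < n" "j < n" for i j
    unfolding field_flag_type_eq_LEAST[OF assms(4) ij L.monoid_axioms]
      field_flag_type_eq_LEAST[OF flag2 ij L2.monoid_axioms]
  proof (rule LEAST_bounded_cong)
    have prod: "F2 i <#>\<^bsub>L2\<^esub> F2 j = f ` (F1 i <#>\<^bsub>L1\<^esub> F1 j)"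
      unfolding F2_def by (rule image_set_mult) (use sub1 carr1 in auto)
    have subp: "F1 i <#>\<^bsub>L1\<^esub> F1 j \<subseteq> M"
      using Mmul sub1 unfolding set_mult_def ops by blast
    show "F i <#>\<^bsub>L\<^esub> F j \<subseteq> F k \<longleftrightarrow> F2 i <#>\<^bsub>L2\<^esub> F2 j \<subseteq> F2 k" if "k < n" for k
    proof -
      have "F2 i <#>\<^bsub>L2\<^esub> F2 j \<subseteq> F2 k \<longleftrightarrow> F1 i <#>\<^bsub>L1\<^esub> F1 j \<subseteq> F1 k"
        unfolding prod unfolding F2_def by (rule image_subset_iff_of_inj[OF f subp sub1])
      moreover have "F1 i <#>\<^bsub>L1\<^esub> F1 j \<subseteq> F1 k" if "F i <#>\<^bsub>L\<^esub> F j \<subseteq> F k"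
        using that subp unfolding F1_def set_mult_def ops by blast
      moreover have "\<not> F1 i <#>\<^bsub>L1\<^esub> F1 j \<subseteq> F1 k" if not: "\<not> F i <#>\<^bsub>L\<^esub> F j \<subseteq> F k"
      proof -
        note w = wit[OF not]
        have "fst (wit i j k) \<in> S" "snd (wit i j k) \<in> S"
          using w sub[OF ij(1)] sub[OF ij(2)] unfolding S_def by blast+
        then have "fst (wit i j k) \<in> F1 i" "snd (wit i j k) \<in> F1 j"
          using w M(2) unfolding F1_def by blast+
        then have "fst (wit i j k) \<otimes>\<^bsub>L\<^esub> snd (wit i j k) \<in> F1 i <#>\<^bsub>L1\<^esub> F1 j"
          unfolding set_mult_def ops by blast
        then show ?thesis using w unfolding F1_def by blast
      qed
      ultimately show ?thesis by blast
    qed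
    show "F i <#>\<^bsub>L\<^esub> F j \<subseteq> F (n - 1)"
      unfolding Fn by (rule L.set_mult_closed[OF sub[OF ij(1)] sub[OF ij(2)]])
  qed (rule n0)
  then have "flag_type_eq n (field_flag_type K L F) (field_flag_type K2 L2 F2)"
    by (simp add: flag_type_eq_def)
  with L2 K2 dimL2 flag2 show ?thesis by blast
qed

theorem realizable_in_imp_realizable:
  assumes "realizable_in TYPE('a) n T"
  shows "realizable n T"
proof -
  have trans: "flag_type_eq n T T''" if "flag_type_eq n T T'" "flag_type_eq n T' T''" for T' T''
    using that by (simp add: flag_type_eq_def)
  from assms have T: "flag_type n T" by (simp add: realizable_in_def)
  from assms consider
    (group) G :: "'a monoid" and F where "comm_group G" "finite (carrier G)" "order G = n"
      "group_flag n G F" "flag_type_eq n T (group_flag_type G F)"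
  | (field) L :: "'a ring" and K F where "field L" "subfield K L"
      "ring.dimension L n K (carrier L)" "field_flag n K L F"
      "flag_type_eq n T (field_flag_type K L F)"
    unfolding realizable_in_def by blast
  then show ?thesis
  proof cases
    case group
    from realizable_group[OF group(1-4)] trans[OF group(5)] T show ?thesis
      unfolding realizable_def realizable_in_def by blast
  next
    case field
    from realizable_field[OF field(1-4)] trans[OF field(5)] T show ?thesis
      unfolding realizable_def realizable_in_def by blast
  qed
qed

end

theory Submission
  imports Defs
begin

text \<open>
  Order the residues modulo \<open>18\<close> by a subadditive weight whose values violate an inequality of each of
  the three tuple polytopes, and let \<open>T\<close> be a minimal flag type below the type of the resulting flag.
  Polytopes grow as flag types decrease, so the weights give a point of \<open>P\<^sub>T\<close> outside the union. If
  every corner satisfied \<open>T(i,j) \<le> i + j\<close>, then this would hold for all \<open>(i,j)\<close>, in particular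
  \<open>T(1,6) \<le> 7\<close>. A counting argument, uniform for groups (cardinalities) and fields (dimensions), shows
  that then \<open>F\<^sub>1\<^sub>1\<close> is a subgroup or subfield of size \<open>12\<close>, although \<open>12\<close> does not divide \<open>18\<close>.
\<close>

section \<open>Corners, minimal elements and polytopes of abstract flag types\<close>

lemma flag_type_0:
  assumes "flag_type n T" "i < n"
  shows "T i 0 = i" and "T 0 i = i"
  using assms unfolding flag_type_def by (metis gr_zeroI not_less_zero)+

text \<open>Descent on \<open>i + j\<close>: at a non-corner, one of the two indices can be lowered
  without decreasing the value, so the excess over the index sum persists. The axes carry no excess,
  since \<open>T i 0 = i\<close>.\<close>

lemma corner_below_exceeding_entry:
  assumes T: "flag_type n T"
  shows "i < n \<Longrightarrow> j < n \<Longrightarrow> T i j > i + j \<Longrightarrow> \<exists>i j. corner n T i j \<and> T i j > i + j"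
proof (induction "i + j" arbitrary: i j rule: less_induct)
  case less
  have "T i 0 = i" "T 0 j = j"
    using flag_type_0[OF T] less.prems by simp_all
  then have pos: "0 < i" "0 < j" using less.prems by (auto intro: gr0I)
  consider "T (i - 1) j < T i j \<and> T i (j - 1) < T i j" | "T i j \<le> T (i - 1) j" | "T i j \<le> T i (j - 1)"
    by linarith
  then show ?case
  proof cases
    case 1
    then show ?thesis using pos less.prems unfolding corner_def by blast
  next
    case 2
    then show ?thesis using less.hyps[of "i - 1" j] pos less.prems by simp
  next
    case 3
    then show ?thesis using less.hyps[of i "j - 1"] pos less.prems by simp
  qed
qed

text \<open>A realizable type below \<open>T0\<close> with the least sum of entries is
  minimal.\<close>

lemma exists_minimal_flag_type_le:
  assumes "realizable n T0"
  obtains T where "minimal_flag_type n T" and "flag_type_le n T T0"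
proof -
  define w where "w T = (\<Sum>i<n. \<Sum>j<n. T i j)" for T :: "nat \<Rightarrow> nat \<Rightarrow> nat"
  obtain T where T: "realizable n T" "flag_type_le n T T0"
    and least: "\<And>T'. realizable n T' \<Longrightarrow> flag_type_le n T' T0 \<Longrightarrow> w T \<le> w T'"
    using ex_has_least_nat[of "\<lambda>T. realizable n T \<and> flag_type_le n T T0" T0 w] assms
    by (auto simp: flag_type_le_def)
  have "flag_type_eq n T' T" if T': "realizable n T'" "flag_type_le n T' T" for T'
  proof (rule ccontr)
    assume "\<not> flag_type_eq n T' T"
    then obtain a b where ab: "a < n" "b < n" "T' a b < T a b"
      using T'(2) unfolding flag_type_eq_def flag_type_le_def by (meson le_neq_implies_less)
    have "w T' < w T" unfolding w_def
    proof (rule sum_strict_mono_ex1)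
      show "\<forall>i\<in>{..<n}. (\<Sum>j<n. T' i j) \<le> (\<Sum>j<n. T i j)"
        using T'(2) by (auto simp: flag_type_le_def intro: sum_mono)
      have "(\<Sum>j<n. T' a j) < (\<Sum>j<n. T a j)"
        using T'(2) ab by (intro sum_strict_mono_ex1) (auto simp: flag_type_le_def)
      then show "\<exists>i\<in>{..<n}. (\<Sum>j<n. T' i j) < (\<Sum>j<n. T i j)" using ab by blast
    qed simp
    moreover have "flag_type_le n T' T0"
      using T'(2) T(2) unfolding flag_type_le_def by (meson order_trans)
    ultimately show False using least[OF T'(1)] by simp
  qed
  with T that show thesis unfolding minimal_flag_type_def by blast
qed

lemma flag_polytope_antimono:
  assumes le: "flag_type_le n T T'" and ft: "flag_type n T" "flag_type n T'"
  shows "flag_polytope n T' \<subseteq> flag_polytope n T"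
proof
  fix x assume x: "x \<in> flag_polytope n T'"
  have "x (T i j) \<le> x i + x j" if ij: "i \<in> {1..<n}" "j \<in> {1..<n}" for i j
  proof -
    have mono: "T a j \<le> T b j" if "a \<le> b" "b < n" for a b
      using that
    proof (induction b)
      case (Suc b)
      have "T b j \<le> T (Suc b) j"
        using ft(1) Suc.prems ij unfolding flag_type_def
        by (metis Suc_eq_plus1 less_diff_conv atLeastLessThan_iff)
      then show ?case using Suc by (auto simp: le_Suc_eq)
    qed simp
    \<comment> \<open>The index 0 is not a coordinate of the polytope, so \<open>T i j\<close> must
      be positive before monotonicity of \<open>x\<close> applies; it is at least
      \<open>T 0 j\<close>.\<close>
    have "T 0 j = j" using flag_type_0[OF ft(1)] ij by simp
    then have "1 \<le> T i j" using mono[of 0 i] ij by auto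
    moreover have "T i j \<le> T' i j" "T' i j < n"
      using le ft(2) ij by (auto simp: flag_type_le_def flag_type_def)
    ultimately have "x (T i j) \<le> x (T' i j)" using x by (auto simp: flag_polytope_def)
    also have "\<dots> \<le> x i + x j" using x ij by (auto simp: flag_polytope_def)
    finally show ?thesis .
  qed
  then show "x \<in> flag_polytope n T" using x by (auto simp: flag_polytope_def)
qed

section \<open>Flag types expressed by containments of products\<close>

text \<open>Containment in \<open>F (n - 1)\<close> makes the least index exist; below
  \<open>n\<close> the chain increases, so containment carries from the least index up to
  \<open>k\<close>.\<close>

lemma Least_flag_le_iff:
  fixes F :: "nat \<Rightarrow> 'a set"
  assumes "\<And>i. Suc i < n \<Longrightarrow> F i \<subseteq> F (Suc i)" and "A \<subseteq> F (n - 1)" and "k < n"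
  shows "(LEAST k. A \<subseteq> F k) \<le> k \<longleftrightarrow> A \<subseteq> F k"
proof
  assume le: "(LEAST k. A \<subseteq> F k) \<le> k"
  have "F l \<subseteq> F k" if "l \<le> k" for l
    using that assms(3)
  proof (induction k)
    case (Suc k)
    then show ?case using assms(1)[of k] by (auto simp: le_Suc_eq)
  qed simp
  moreover have "A \<subseteq> F (LEAST k. A \<subseteq> F k)" using assms(2) by (rule LeastI)
  ultimately show "A \<subseteq> F k" using le by blast
qed (rule Least_le)

lemma group_flag_type_le_iff:
  assumes "group G" and "group_flag n G F" and "i < n" "j < n" "k < n"
  shows "group_flag_type G F i j \<le> k \<longleftrightarrow> F i <#>\<^bsub>G\<^esub> F j \<subseteq> F k"
  unfolding group_flag_type_def
proof (rule Least_flag_le_iff)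
  interpret group G by fact
  show "F i \<subseteq> F (Suc i)" if "Suc i < n" for i
    using assms(2) that unfolding group_flag_def
    by (metis Suc_eq_plus1 less_diff_conv psubset_imp_subset)
  have "F i <#>\<^bsub>G\<^esub> F j \<subseteq> carrier G"
    using assms group_flag_subset_carrier[of n G F] by (intro set_mult_closed) auto
  then show "F i <#>\<^bsub>G\<^esub> F j \<subseteq> F (n - 1)" using assms(2) by (simp add: group_flag_def)
qed fact

lemma field_flag_type_le_iff:
  assumes "field L" and "field_flag n K L F" and "i < n" "j < n" "k < n"
  shows "field_flag_type K L F i j \<le> k \<longleftrightarrow> F i <#>\<^bsub>L\<^esub> F j \<subseteq> F k"
proof -
  interpret field L by fact
  have "(LEAST k. F i <#>\<^bsub>L\<^esub> F j \<subseteq> F k) \<le> k \<longleftrightarrow> F i <#>\<^bsub>L\<^esub> F j \<subseteq> F k"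
  proof (rule Least_flag_le_iff)
    show "F i \<subseteq> F (Suc i)" if "Suc i < n" for i
      using assms(2) that unfolding field_flag_def
      by (metis Suc_eq_plus1 less_diff_conv psubset_imp_subset)
    have "F i <#>\<^bsub>L\<^esub> F j \<subseteq> carrier L"
      using assms field_flag_subset_carrier[of n K L F] by (intro set_mult_closed) auto
    then show "F i <#>\<^bsub>L\<^esub> F j \<subseteq> F (n - 1)" using assms(2) by (simp add: field_flag_def)
  qed fact
  then show ?thesis using field_flag_type_eq_LEAST[OF assms(2-4) monoid_axioms] by simp
qed

section \<open>The counting argument, uniform for groups and fields\<close>

text \<open>\<open>V\<close> holds for the subsets of a group, respectively for the \<open>K\<close>-subspaces of a field; the last two
  axioms say that \<open>F\<^sub>j\<close> and \<open>F\<^sub>au\<close> are independent when \<open>F\<^sub>a\<close> is a subgroup or subfield stabilizing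
  \<open>F\<^sub>j\<close> and \<open>u \<notin> F\<^sub>j\<close>.\<close>

locale closed_flag = comm_monoid G for G (structure) +
  fixes n :: nat and F :: "nat \<Rightarrow> 'a set" and V :: "'a set \<Rightarrow> bool"
  assumes F_closed: "i < n \<Longrightarrow> V (F i)"
    and F_carrier: "i < n \<Longrightarrow> F i \<subseteq> carrier G"
    and F_strict: "Suc i < n \<Longrightarrow> F i \<subset> F (Suc i)"
    and F_last: "F (n - 1) = carrier G"
    and scale: "V S \<Longrightarrow> c \<in> F 0 \<Longrightarrow> u \<in> S \<Longrightarrow> c \<otimes> u \<in> S"
    and preimage: "V S \<Longrightarrow> u \<in> carrier G \<Longrightarrow> V {z \<in> carrier G. z \<otimes> u \<in> S}"
    and counting: "\<lbrakk>F a <#> F a \<subseteq> F a; F a <#> F j \<subseteq> F j; a < n; j \<le> k; k < n;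
        u \<in> F k; u \<notin> F j; \<And>z. z \<in> F a \<Longrightarrow> z \<otimes> u \<in> F k\<rbrakk> \<Longrightarrow> j + a < k"
    and generating: "\<lbrakk>F a <#> F a \<subseteq> F a; F a <#> F j \<subseteq> F j; a < n; Suc (j + a) < n;
        u \<in> F (Suc (j + a)); u \<notin> F j; \<And>z. z \<in> F a \<Longrightarrow> z \<otimes> u \<in> F (Suc (j + a));
        V S; F j \<subseteq> S; \<And>z. z \<in> F a \<Longrightarrow> z \<otimes> u \<in> S\<rbrakk> \<Longrightarrow> F (Suc (j + a)) \<subseteq> S"
begin

lemma F_mono: "i \<le> j \<Longrightarrow> j < n \<Longrightarrow> F i \<subseteq> F j"
proof (induction j)
  case (Suc j)
  then show ?case using F_strict[of j] by (auto simp: le_Suc_eq)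
qed simp

text \<open>The case \<open>a = 0\<close> of \<open>generating\<close>: sets satisfying
  \<open>V\<close> are stable under \<open>F 0\<close>, so \<open>F i\<close> and one new element
  already generate \<open>F (Suc i)\<close>.\<close>

lemma Suc_subsetI:
  assumes "Suc i < n" "w \<in> F (Suc i)" "w \<notin> F i" "V S" "F i \<subseteq> S" "w \<in> S"
  shows "F (Suc i) \<subseteq> S"
proof -
  have sub: "F 0 <#> F j \<subseteq> F j" if "j < n" for j
    using scale[OF F_closed[OF that]] by (auto simp: set_mult_def)
  have "F (Suc (i + 0)) \<subseteq> S"
    by (rule generating[where u = w])
      (use assms sub scale[OF F_closed] scale[OF assms(4)] in auto)
  then show ?thesis by simp
qed

text \<open>If \<open>F\<^sub>1F\<^sub>6 \<subseteq> F\<^sub>7\<close>, then \<open>F\<^sub>2F\<^sub>6F\<^sub>6 \<subseteq> F\<^sub>7F\<^sub>7 \<subseteq> F\<^sub>1\<^sub>3\<close>, so that \<open>F\<^sub>6F\<^sub>6 \<subseteq> F\<^sub>1\<^sub>1\<close> because the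
  \<open>F\<^sub>2\<close>-stable set \<open>F\<^sub>1\<^sub>1\<close> has codimension \<open>2 < 3\<close> in \<open>F\<^sub>1\<^sub>3\<close>. As \<open>F\<^sub>1\<^sub>1\<close> is generated by \<open>F\<^sub>6\<close> over
  \<open>F\<^sub>5\<close>, it would be a subgroup or subfield of size \<open>12\<close>, which does not divide \<open>18\<close>.\<close>

lemma F1_F6_exceeds_F7:
  assumes n: "n = 18"
    and p22: "F 2 <#> F 2 \<subseteq> F 2" and p55: "F 5 <#> F 5 \<subseteq> F 5" and p56: "F 5 <#> F 6 \<subseteq> F 11"
    and p511: "F 5 <#> F 11 \<subseteq> F 11" and p211: "F 2 <#> F 11 \<subseteq> F 11" and p77: "F 7 <#> F 7 \<subseteq> F 13"
  shows "\<not> F 1 <#> F 6 \<subseteq> F 7"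
proof
  assume p16: "F 1 <#> F 6 \<subseteq> F 7"
  have mult: "x \<otimes> y \<in> C" if "A <#> B \<subseteq> C" "x \<in> A" "y \<in> B" for A B C x y
    using that by (auto simp: set_mult_def)
  have carr: "x \<in> carrier G" if "x \<in> F i" "i < 18" for x i
    using F_carrier[of i] that n by blast
  obtain v where v: "v \<in> F 2" "v \<notin> F 1" using F_strict[of 1] n by (auto simp: numeral_2_eq_2)
  have F12: "F 1 \<subseteq> F 2" using F_mono n by simp
  \<comment> \<open>Sizes are indices plus one. A closed \<open>F 1\<close> and its independent
    translate by \<open>v\<close> would need size 4 inside \<open>F 2\<close>, which has size 3.
    Hence some product \<open>a \<otimes> b\<close> leaves \<open>F 1\<close>, and it generates
    \<open>F 2\<close> over \<open>F 1\<close>.\<close>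
  have "\<not> F 1 <#> F 1 \<subseteq> F 1"
  proof
    assume p11: "F 1 <#> F 1 \<subseteq> F 1"
    have "1 + 1 < (2::nat)"
      by (rule counting[OF p11 p11, where u = v]) (use v n F12 mult[OF p22] in auto)
    then show False by simp
  qed
  then obtain a b where ab: "a \<in> F 1" "b \<in> F 1" "a \<otimes> b \<notin> F 1" by (auto simp: set_mult_def)
  have ab2: "a \<otimes> b \<in> F 2" using ab F12 mult[OF p22] by blast
  have p66: "p \<otimes> q \<in> F 11" if pq: "p \<in> F 6" "q \<in> F 6" for p q
  proof (rule ccontr)
    assume not: "p \<otimes> q \<notin> F 11"
    note c = carr[OF pq(1)] carr[OF pq(2)] carr[OF ab(1)] carr[OF ab(2)]
    have F67: "F 6 \<subseteq> F 7" using F_mono n by simp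
    \<comment> \<open>The multipliers taking \<open>p \<otimes> q\<close> into \<open>F 13\<close>.
      They include \<open>F 1\<close> by \<open>(z \<otimes> p) \<otimes> q\<close> and
      \<open>a \<otimes> b\<close> by \<open>(a \<otimes> p) \<otimes> (b \<otimes> q)\<close>, both
      in \<open>F 7 <#> F 7\<close>; hence they include \<open>F 2\<close>.\<close>
    define S where "S = {z \<in> carrier G. z \<otimes> (p \<otimes> q) \<in> F 13}"
    have "F (Suc 1) \<subseteq> S"
    proof (rule Suc_subsetI)
      show "V S" unfolding S_def by (rule preimage[OF F_closed]) (use n c in auto)
      show "F 1 \<subseteq> S"
      proof
        fix z assume z: "z \<in> F 1"
        have "(z \<otimes> p) \<otimes> q \<in> F 13"
          using mult[OF p77] mult[OF p16] z pq F67 by blast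
        then show "z \<in> S" unfolding S_def using z c carr[OF z] by (simp add: m_assoc)
      qed
      have "(a \<otimes> p) \<otimes> (b \<otimes> q) \<in> F 13"
        using mult[OF p77] mult[OF p16] ab pq by blast
      then show "a \<otimes> b \<in> S" unfolding S_def using c by (simp add: m_ac)
    qed (use n ab ab2 in \<open>auto simp: numeral_2_eq_2\<close>)
    then have st: "z \<otimes> (p \<otimes> q) \<in> F 13" if "z \<in> F 2" for z
      using that unfolding S_def by (auto simp: numeral_2_eq_2)
    have "p \<otimes> q \<in> F 13" using mult[OF p77] pq F67 by blast
    \<comment> \<open>\<open>F 13\<close> exceeds \<open>F 11\<close> by only 2, which leaves no
      room for the translate of \<open>F 2\<close> by \<open>p \<otimes> q\<close>, of size
      3.\<close>
    then have "11 + 2 < (13::nat)"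
      by (rule counting[OF p22 p211, rotated 3, OF _ not]) (use n st in auto)
    then show False by simp
  qed
  obtain g where g: "g \<in> F 6" "g \<notin> F 5" using F_strict[of 5] n by auto
  \<comment> \<open>\<open>generating\<close> applies with \<open>a = j = 5\<close> because the
    sizes 6 + 6 fill \<open>F 11\<close> exactly.\<close>
  have gen: "F 11 \<subseteq> S" if "V S" "F 5 \<subseteq> S" "\<And>z. z \<in> F 5 \<Longrightarrow> z \<otimes> g \<in> S" for S
  proof -
    have "F (Suc (5 + 5)) \<subseteq> S"
      by (rule generating[OF p55 p55, where u = g])
        (use that g n mult[OF p56] F_mono[of 6 11] in auto)
    then show ?thesis by simp
  qed
  have F611: "F 6 \<subseteq> F 11" and F511: "F 5 \<subseteq> F 11" using F_mono n by auto
  \<comment> \<open>Multiplication by \<open>p\<close> need only be tested on \<open>F 5\<close> and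
    on its translate by \<open>g\<close>; for the latter,
    \<open>(z \<otimes> g) \<otimes> p = z \<otimes> (g \<otimes> p)\<close> lies in
    \<open>F 5 <#> F 11\<close>.\<close>
  have step: "z \<otimes> p \<in> F 11"
    if p: "p \<in> F 11" and p5: "F 5 <#> {p} \<subseteq> F 11" and gp: "g \<otimes> p \<in> F 11" and z: "z \<in> F 11" for p z
  proof -
    have "F 11 \<subseteq> {z \<in> carrier G. z \<otimes> p \<in> F 11}"
    proof (rule gen)
      show "V {z \<in> carrier G. z \<otimes> p \<in> F 11}"
        by (rule preimage[OF F_closed]) (use n carr[OF p] in auto)
      show "F 5 \<subseteq> {z \<in> carrier G. z \<otimes> p \<in> F 11}"
        using mult[OF p5] carr[of _ 5] by auto
      show "z \<otimes> g \<in> {z \<in> carrier G. z \<otimes> p \<in> F 11}" if "z \<in> F 5" for z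
        using mult[OF p511 that gp] carr[OF that] carr[OF p] carr[OF g(1)] by (simp add: m_assoc)
    qed
    then show ?thesis using z by blast
  qed
  \<comment> \<open>Two rounds of \<open>step\<close>: right factors from \<open>F 6\<close> rely on
    \<open>p66\<close>; right factors \<open>q\<close> from \<open>F 11\<close> then use the first
    round for \<open>g \<otimes> q = q \<otimes> g\<close>.\<close>
  have p116: "z \<otimes> p \<in> F 11" if "z \<in> F 11" "p \<in> F 6" for z p
    by (rule step) (use that F611 p66[OF g(1)] mult[OF p56] in \<open>auto simp: set_mult_def\<close>)
  have p1111: "z \<otimes> q \<in> F 11" if zq: "z \<in> F 11" "q \<in> F 11" for z q
  proof (rule step)
    have "q \<otimes> g \<in> F 11" using p116 zq g by blast
    then show "g \<otimes> q \<in> F 11" using carr[OF zq(2)] carr[OF g(1)] by (simp add: m_comm)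
  qed (use zq mult[OF p511] in \<open>auto simp: set_mult_def\<close>)
  then have closed: "F 11 <#> F 11 \<subseteq> F 11" by (auto simp: set_mult_def)
  \<comment> \<open>A closed \<open>F 11\<close> and its independent translate by \<open>u\<close>
    would need size 24 inside the whole, of size 18.\<close>
  obtain u where u: "u \<in> F 12" "u \<notin> F 11" using F_strict[of 11] n by auto
  have "z \<otimes> u \<in> F 17" if "z \<in> F 11" for z
    using F_last n carr[OF that] carr[OF u(1)] by simp
  then have "11 + 11 < (17::nat)"
    by (rule counting[OF closed closed, rotated 5]) (use u n F_mono[of 12 17] in auto)
  then show False by simp
qed

end

section \<open>Groups and fields as instances of \<open>closed_flag\<close>\<close>

text \<open>Translation by \<open>a\<close> is an injective self-map of a finite set, hence onto.
  When \<open>A\<close> contains the unit, this supplies inverses inside \<open>A\<close>.\<close>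

lemma set_mult_singleton_eq:
  assumes "comm_group G" "finite A" "A \<subseteq> carrier G" "A <#>\<^bsub>G\<^esub> A \<subseteq> A" "a \<in> A"
  shows "(\<lambda>b. a \<otimes>\<^bsub>G\<^esub> b) ` A = A"
proof (rule endo_inj_surj)
  interpret comm_group G by fact
  show "inj_on ((\<otimes>\<^bsub>G\<^esub>) a) A"
    using assms(3,5) by (intro inj_onI) (auto simp: subset_iff)
qed (use assms in \<open>auto simp: set_mult_def\<close>)

lemma closed_flag_group:
  fixes G (structure)
  assumes "comm_group G" and flag: "group_flag n G F" and fin: "finite (carrier G)"
  shows "closed_flag G n F (\<lambda>S. S \<subseteq> carrier G)"
proof -
  interpret comm_group G by fact
  have carr: "F i \<subseteq> carrier G" if "i < n" for i by (rule group_flag_subset_carrier[OF flag that])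
  have card: "card (F i) = Suc i" if "i < n" for i using flag that by (simp add: group_flag_def)
  have finF: "finite (F i)" if "i < n" for i using finite_subset[OF carr[OF that] fin] .
  have strict: "F i \<subset> F (Suc i)" if "Suc i < n" for i
    using flag that unfolding group_flag_def by (metis Suc_eq_plus1 less_diff_conv)
  have mono: "F i \<subseteq> F j" if "i \<le> j" "j < n" for i j
    using that
  proof (induction j)
    case (Suc j)
    then show ?case using strict[of j] by (auto simp: le_Suc_eq)
  qed simp
  \<comment> \<open>If \<open>z \<otimes> u\<close> lay in \<open>F j\<close>, the inverse of
    \<open>z\<close>, which is in \<open>F a\<close>, would bring \<open>u\<close> back into
    \<open>F j\<close>. So the union is disjoint and sizes add; \<open>counting\<close> and
    \<open>generating\<close> both follow.\<close>
  have card_union: "F j \<union> (\<lambda>z. z \<otimes> u) ` F a \<subseteq> F k \<and> card (F j \<union> (\<lambda>z. z \<otimes> u) ` F a) = Suc (Suc (j + a))"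
    if A: "F a <#> F a \<subseteq> F a" and W: "F a <#> F j \<subseteq> F j" and le: "a < n" "j \<le> k" "k < n"
      and u: "u \<in> F k" "u \<notin> F j" and uk: "\<And>z. z \<in> F a \<Longrightarrow> z \<otimes> u \<in> F k" for a j k u
  proof -
    have uc: "u \<in> carrier G" using u carr le by blast
    have "F j \<inter> (\<lambda>z. z \<otimes> u) ` F a = {}"
    proof (rule equals0I, clarify)
      fix z assume z: "z \<in> F a" "z \<otimes> u \<in> F j"
      have "\<one> \<in> F 0" using flag by (simp add: group_flag_def)
      then have "\<one> \<in> F a" using mono[of 0 a] le by blast
      then obtain b where b: "b \<in> F a" "\<one> = z \<otimes> b"
        using set_mult_singleton_eq[OF assms(1) finF carr A z(1)] le by blast
      have bc: "b \<in> carrier G" "z \<in> carrier G" using b z carr le by blast+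
      have "b \<otimes> (z \<otimes> u) = (z \<otimes> b) \<otimes> u" using bc uc by (simp add: m_ac)
      then have "b \<otimes> (z \<otimes> u) = u" using b(2)[symmetric] uc by simp
      moreover have "b \<otimes> (z \<otimes> u) \<in> F j" using W b(1) z(2) by (auto simp: set_mult_def)
      ultimately show False using u by simp
    qed
    moreover have "inj_on (\<lambda>z. z \<otimes> u) (F a)"
      using carr[OF le(1)] uc by (intro inj_onI) (auto simp: subset_iff)
    ultimately have "card (F j \<union> (\<lambda>z. z \<otimes> u) ` F a) = Suc j + Suc a"
      using le finF card by (simp add: card_Un_disjoint card_image)
    then show ?thesis using mono[OF le(2,3)] uk by auto
  qed
  show ?thesis
  proof (intro closed_flag.intro closed_flag_axioms.intro comm_monoid_axioms)
    show "j + a < k"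
      if "F a <#> F a \<subseteq> F a" "F a <#> F j \<subseteq> F j" "a < n" "j \<le> k" "k < n"
        "u \<in> F k" "u \<notin> F j" "\<And>z. z \<in> F a \<Longrightarrow> z \<otimes> u \<in> F k" for a j k u
      using card_union[OF that] card_mono[OF finF[OF that(5)], of "F j \<union> (\<lambda>z. z \<otimes> u) ` F a"] card[OF that(5)]
      by linarith
    show "F (Suc (j + a)) \<subseteq> S"
      if A: "F a <#> F a \<subseteq> F a" "F a <#> F j \<subseteq> F j" "a < n" "Suc (j + a) < n" "u \<in> F (Suc (j + a))"
        "u \<notin> F j" "\<And>z. z \<in> F a \<Longrightarrow> z \<otimes> u \<in> F (Suc (j + a))" and S: "F j \<subseteq> S"
        "\<And>z. z \<in> F a \<Longrightarrow> z \<otimes> u \<in> S" for a j u S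
    proof -
      have "F j \<union> (\<lambda>z. z \<otimes> u) ` F a = F (Suc (j + a))"
        using card_union[OF A(1-3) _ A(4-7)] card[OF A(4)] by (intro card_subset_eq finF A) auto
      then show ?thesis using S by blast
    qed
    show "F (n - 1) = carrier G" using flag by (simp add: group_flag_def)
    show "c \<otimes> u \<in> S" if "S \<subseteq> carrier G" "c \<in> F 0" "u \<in> S" for S c u
    proof -
      have "c = \<one>" using flag that(2) by (simp add: group_flag_def)
      then show ?thesis using that by auto
    qed
  qed (use carr strict in auto)
qed

context field
begin

text \<open>Multiplication by \<open>u \<noteq> \<zero>\<close> is injective and turns each line
  extension building up \<open>E\<close> into a line extension.\<close>

lemma dimension_r_coset:
  assumes K: "subfield K R" and "dimension m K E" and u: "u \<in> carrier R" "u \<noteq> \<zero>"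
  shows "dimension m K ((\<lambda>z. z \<otimes> u) ` E)"
  using assms(2) K
proof (induction rule: dimension.induct)
  case (zero_dim K)
  then show ?case using u by auto
next
  case (Suc_dim v E m K)
  have E: "E \<subseteq> carrier R" and K: "K \<subseteq> carrier R"
    using space_subgroup_props(1) subfieldE(3) Suc_dim by blast+
  have "v \<otimes> u \<notin> (\<lambda>z. z \<otimes> u) ` E"
    using Suc_dim.hyps(1,2) E u m_rcancel by (auto simp: subset_iff)
  moreover have "(\<lambda>z. z \<otimes> u) ` line_extension K v E = line_extension K (v \<otimes> u) ((\<lambda>z. z \<otimes> u) ` E)"
  proof -
    have eq: "(k \<otimes> v \<oplus> e) \<otimes> u = k \<otimes> (v \<otimes> u) \<oplus> e \<otimes> u" if "k \<in> K" "e \<in> E" for k e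
      using that Suc_dim.hyps(1) K E u by (simp add: l_distr m_assoc subset_iff)
    show ?thesis
    proof (intro equalityI subsetI)
      fix y assume "y \<in> (\<lambda>z. z \<otimes> u) ` line_extension K v E"
      then show "y \<in> line_extension K (v \<otimes> u) ((\<lambda>z. z \<otimes> u) ` E)"
        using eq by (auto simp: line_extension_mem_iff) blast
    next
      fix y assume "y \<in> line_extension K (v \<otimes> u) ((\<lambda>z. z \<otimes> u) ` E)"
      then obtain k e where ke: "k \<in> K" "e \<in> E" "y = (k \<otimes> v \<oplus> e) \<otimes> u"
        using eq by (auto simp: line_extension_mem_iff)
      then show "y \<in> (\<lambda>z. z \<otimes> u) ` line_extension K v E"
        by (intro image_eqI[where x = "k \<otimes> v \<oplus> e"]) (use ke in \<open>auto simp: line_extension_mem_iff\<close>)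
    qed
  qed
  ultimately show ?case
    using dimension.Suc_dim[of "v \<otimes> u" "(\<lambda>z. z \<otimes> u) ` E" m K] Suc_dim E u by auto
qed

lemma subspace_dimension_le:
  assumes K: "subfield K R" and "dimension l K D" "dimension m K E" "D \<subseteq> E"
  shows "l \<le> m" and "l = m \<Longrightarrow> D = E"
proof -
  obtain Us where Us: "set Us \<subseteq> carrier R" "independent K Us" "length Us = l" "Span K Us = D"
    using exists_base[OF K assms(2)] by blast
  then have "set Us \<subseteq> E" using Span_base_incl[OF K Us(1)] assms(4) by blast
  then show "l \<le> m" "l = m \<Longrightarrow> D = E"
    using independent_length_le_dimension[OF K assms(3) Us(2)]
      independent_length_eq_dimension[OF K assms(3) Us(2)] Us by auto
qed

text \<open>Linear analogue of \<open>set_mult_singleton_eq\<close>: the image lies in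
  \<open>A\<close> and has the same dimension.\<close>

lemma subspace_mult_image_eq:
  assumes K: "subfield K R" and A: "dimension m K A" "A <#> A \<subseteq> A" and a: "a \<in> A" "a \<noteq> \<zero>"
  shows "(\<lambda>b. b \<otimes> a) ` A = A"
proof (rule subspace_dimension_le(2)[OF K _ A(1)])
  have "A \<subseteq> carrier R" by (rule space_subgroup_props(1)[OF K A(1)])
  with a A(1) K show "dimension m K ((\<lambda>b. b \<otimes> a) ` A)"
    by (intro dimension_r_coset) auto
qed (use A(2) a in \<open>auto simp: set_mult_def\<close>)

end

lemma closed_flag_field:
  assumes "field L" and K: "subfield K L" and flag: "field_flag n K L F"
  shows "closed_flag L n F (\<lambda>S. subalgebra K S L)"
proof -
  interpret field L by fact
  have carr: "F i \<subseteq> carrier L" if "i < n" for i by (rule field_flag_subset_carrier[OF flag that])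
  have dim: "dimension (Suc i) K (F i)" and alg: "subalgebra K (F i) L" if "i < n" for i
    using flag that by (simp_all add: field_flag_def)
  have F0: "F 0 = K" using flag by (simp add: field_flag_def)
  have strict: "F i \<subset> F (Suc i)" if "Suc i < n" for i
    using flag that unfolding field_flag_def by (metis Suc_eq_plus1 less_diff_conv)
  have mono: "F i \<subseteq> F j" if "i \<le> j" "j < n" for i j
    using that
  proof (induction j)
    case (Suc j)
    then show ?case using strict[of j] by (auto simp: le_Suc_eq)
  qed simp
  have add: "x \<oplus>\<^bsub>L\<^esub> y \<in> S" if "subalgebra K S L" "x \<in> S" "y \<in> S" for S x y
    using subgroup.m_closed[OF subalgebra.axioms(1)[OF that(1)]] that by simp
  \<comment> \<open>The counterpart of the disjoint union for groups: inverting a nonzero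
    \<open>z\<close> in \<open>F a\<close> shows that the two subspaces meet only in zero, so
    dimensions add.\<close>
  have dim_sum: "F j <+>\<^bsub>L\<^esub> (\<lambda>z. z \<otimes>\<^bsub>L\<^esub> u) ` F a \<subseteq> F k \<and>
      dimension (Suc (Suc (j + a))) K (F j <+>\<^bsub>L\<^esub> (\<lambda>z. z \<otimes>\<^bsub>L\<^esub> u) ` F a)"
    if A: "F a <#>\<^bsub>L\<^esub> F a \<subseteq> F a" and W: "F a <#>\<^bsub>L\<^esub> F j \<subseteq> F j" and le: "a < n" "j \<le> k" "k < n"
      and u: "u \<in> F k" "u \<notin> F j" and uk: "\<And>z. z \<in> F a \<Longrightarrow> z \<otimes>\<^bsub>L\<^esub> u \<in> F k" for a j k u
  proof -
    have uc: "u \<in> carrier L" using u carr le by blast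
    have z0: "\<zero>\<^bsub>L\<^esub> \<in> F i" if "i < n" for i using space_subgroup_props(2)[OF K dim[OF that]] .
    have u0: "u \<noteq> \<zero>\<^bsub>L\<^esub>" using u z0[of j] le by auto
    have "F j \<inter> (\<lambda>z. z \<otimes>\<^bsub>L\<^esub> u) ` F a = {\<zero>\<^bsub>L\<^esub>}"
    proof -
      have "z = \<zero>\<^bsub>L\<^esub>" if z: "z \<in> F a" "z \<otimes>\<^bsub>L\<^esub> u \<in> F j" for z
      proof (rule ccontr)
        assume "z \<noteq> \<zero>\<^bsub>L\<^esub>"
        have "\<one>\<^bsub>L\<^esub> \<in> F a" using subringE(3)[OF subfieldE(1)[OF K]] F0 mono[of 0 a] le by auto
        then obtain b where b: "b \<in> F a" "\<one>\<^bsub>L\<^esub> = b \<otimes>\<^bsub>L\<^esub> z"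
          using subspace_mult_image_eq[OF K dim[OF le(1)] A z(1) \<open>z \<noteq> \<zero>\<^bsub>L\<^esub>\<close>] by blast
        have bc: "b \<in> carrier L" "z \<in> carrier L" using b z carr le by blast+
        have "b \<otimes>\<^bsub>L\<^esub> (z \<otimes>\<^bsub>L\<^esub> u) = (b \<otimes>\<^bsub>L\<^esub> z) \<otimes>\<^bsub>L\<^esub> u" using bc uc by (simp add: m_assoc)
        then have "b \<otimes>\<^bsub>L\<^esub> (z \<otimes>\<^bsub>L\<^esub> u) = u" using b(2)[symmetric] uc by simp
        moreover have "b \<otimes>\<^bsub>L\<^esub> (z \<otimes>\<^bsub>L\<^esub> u) \<in> F j" using W b(1) z(2) by (auto simp: set_mult_def)
        ultimately show False using u by simp
      qed
      then have "z \<otimes>\<^bsub>L\<^esub> u = \<zero>\<^bsub>L\<^esub>" if "z \<in> F a" "z \<otimes>\<^bsub>L\<^esub> u \<in> F j" for z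
        using that uc l_null by metis
      then have "F j \<inter> (\<lambda>z. z \<otimes>\<^bsub>L\<^esub> u) ` F a \<subseteq> {\<zero>\<^bsub>L\<^esub>}" by blast
      moreover have "\<zero>\<^bsub>L\<^esub> \<in> (\<lambda>z. z \<otimes>\<^bsub>L\<^esub> u) ` F a"
        using z0[OF le(1)] uc by (intro image_eqI[of _ _ "\<zero>\<^bsub>L\<^esub>"]) auto
      moreover have "\<zero>\<^bsub>L\<^esub> \<in> F j" by (rule z0) (use le in linarith)
      ultimately show ?thesis by blast
    qed
    moreover have "dimension (Suc a) K ((\<lambda>z. z \<otimes>\<^bsub>L\<^esub> u) ` F a)"
      using dimension_r_coset[OF K dim[OF le(1)] uc u0] .
    ultimately have "dimension (Suc j + Suc a) K (F j <+>\<^bsub>L\<^esub> (\<lambda>z. z \<otimes>\<^bsub>L\<^esub> u) ` F a)"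
      using dim[of j] le by (intro dimension_direct_sum_space[OF K]) auto
    moreover have "F j <+>\<^bsub>L\<^esub> (\<lambda>z. z \<otimes>\<^bsub>L\<^esub> u) ` F a \<subseteq> F k"
      using add[OF alg[OF le(3)]] mono[OF le(2,3)] uk by (auto simp: set_add_def set_mult_def)
    ultimately show ?thesis by simp
  qed
  show ?thesis
  proof (intro closed_flag.intro closed_flag_axioms.intro comm_monoid_axioms)
    show "j + a < k"
      if "F a <#>\<^bsub>L\<^esub> F a \<subseteq> F a" "F a <#>\<^bsub>L\<^esub> F j \<subseteq> F j" "a < n" "j \<le> k" "k < n"
        "u \<in> F k" "u \<notin> F j" "\<And>z. z \<in> F a \<Longrightarrow> z \<otimes>\<^bsub>L\<^esub> u \<in> F k" for a j k u
      using dim_sum[OF that] subspace_dimension_le(1)[OF K _ dim[OF that(5)]] by fastforce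
    show "F (Suc (j + a)) \<subseteq> S"
      if A: "F a <#>\<^bsub>L\<^esub> F a \<subseteq> F a" "F a <#>\<^bsub>L\<^esub> F j \<subseteq> F j" "a < n" "Suc (j + a) < n"
        "u \<in> F (Suc (j + a))" "u \<notin> F j" "\<And>z. z \<in> F a \<Longrightarrow> z \<otimes>\<^bsub>L\<^esub> u \<in> F (Suc (j + a))"
        and S: "subalgebra K S L" "F j \<subseteq> S" "\<And>z. z \<in> F a \<Longrightarrow> z \<otimes>\<^bsub>L\<^esub> u \<in> S" for a j u S
    proof -
      have "F j <+>\<^bsub>L\<^esub> (\<lambda>z. z \<otimes>\<^bsub>L\<^esub> u) ` F a = F (Suc (j + a))"
        using dim_sum[OF A(1-3) _ A(4-7)] subspace_dimension_le(2)[OF K _ dim[OF A(4)]] by simp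
      moreover have "F j <+>\<^bsub>L\<^esub> (\<lambda>z. z \<otimes>\<^bsub>L\<^esub> u) ` F a \<subseteq> S"
        using add[OF S(1)] S(2,3) by (auto simp: set_add_def set_mult_def)
      ultimately show ?thesis by simp
    qed
    show "F (n - 1) = carrier L" using flag by (simp add: field_flag_def)
    show "c \<otimes>\<^bsub>L\<^esub> u \<in> S" if "subalgebra K S L" "c \<in> F 0" "u \<in> S" for S c u
      using subalgebra.smult_closed[OF that(1)] that F0 by simp
    show "subalgebra K {z \<in> carrier L. z \<otimes>\<^bsub>L\<^esub> u \<in> S} L"
      if S: "subalgebra K S L" and u: "u \<in> carrier L" for S u
    proof -
      note gr = subalgebra.axioms(1)[OF S]
      have KL: "K \<subseteq> carrier L" by (rule subfieldE(3)[OF K])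
      have "subgroup {z \<in> carrier L. z \<otimes>\<^bsub>L\<^esub> u \<in> S} (add_monoid L)"
      proof (rule add.subgroupI)
        have "\<zero>\<^bsub>L\<^esub> \<in> S" using subgroup.one_closed[OF gr] by simp
        then have "\<zero>\<^bsub>L\<^esub> \<in> {z \<in> carrier L. z \<otimes>\<^bsub>L\<^esub> u \<in> S}" using u by simp
        then show "{z \<in> carrier L. z \<otimes>\<^bsub>L\<^esub> u \<in> S} \<noteq> {}" by blast
        show "\<ominus>\<^bsub>L\<^esub> z \<in> {z \<in> carrier L. z \<otimes>\<^bsub>L\<^esub> u \<in> S}" if "z \<in> {z \<in> carrier L. z \<otimes>\<^bsub>L\<^esub> u \<in> S}" for z
          using that u subgroup.m_inv_closed[OF gr] by (simp add: a_inv_def[symmetric] l_minus)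
      qed (use add[OF S] u in \<open>auto simp: l_distr\<close>)
      then show ?thesis
        using subalgebra.smult_closed[OF S] KL u
        by (auto simp: subalgebra_def subalgebra_axioms_def m_assoc subset_iff)
    qed
  qed (use carr strict alg in auto)
qed

section \<open>A forced large entry in degree 18\<close>

text \<open>The hypotheses are upper bounds on entries, so they pass to every smaller type; this
  lets the conclusion reach a minimal type that is not known explicitly.\<close>

lemma realizable_imp_large_entry:
  assumes T: "realizable 18 T"
    and le: "T 2 2 \<le> 2" "T 5 5 \<le> 5" "T 5 6 \<le> 11" "T 5 11 \<le> 11" "T 2 11 \<le> 11" "T 7 7 \<le> 13"
  shows "T 1 6 > 7"
proof -
  from T consider
    (group) G :: "nat monoid" and F where "comm_group G" "finite (carrier G)"
      "group_flag 18 G F" "flag_type_eq 18 T (group_flag_type G F)"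
  | (field) L :: "nat ring" and K F where "field L" "subfield K L"
      "field_flag 18 K L F" "flag_type_eq 18 T (field_flag_type K L F)"
    unfolding realizable_def realizable_in_def by blast
  then show ?thesis
  proof cases
    case group
    interpret closed_flag G 18 F "\<lambda>S. S \<subseteq> carrier G"
      by (rule closed_flag_group) (use group in auto)
    have "T i j \<le> k \<longleftrightarrow> F i <#>\<^bsub>G\<^esub> F j \<subseteq> F k" if "i < 18" "j < 18" "k < 18" for i j k
      using group_flag_type_le_iff[OF comm_group.axioms(2)[OF group(1)] group(3) that] group(4) that
      by (simp add: flag_type_eq_def)
    then show ?thesis using F1_F6_exceeds_F7 le by (simp add: not_le[symmetric])
  next
    case field
    interpret closed_flag L 18 F "\<lambda>S. subalgebra K S L"
      by (rule closed_flag_field) (use field in auto)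
    have "T i j \<le> k \<longleftrightarrow> F i <#>\<^bsub>L\<^esub> F j \<subseteq> F k" if "i < 18" "j < 18" "k < 18" for i j k
      using field_flag_type_le_iff[OF field(1,3) that] field(4) that
      by (simp add: flag_type_eq_def)
    then show ?thesis using F1_F6_exceeds_F7 le by (simp add: not_le[symmetric])
  qed
qed

lemma flag_type_group_flag_type:
  fixes G (structure)
  assumes "comm_group G" and flag: "group_flag n G F"
  shows "flag_type n (group_flag_type G F)"
proof -
  interpret comm_group G by fact
  let ?T = "group_flag_type G F"
  have carr: "F i \<subseteq> carrier G" if "i < n" for i by (rule group_flag_subset_carrier[OF flag that])
  have strict: "F i \<subset> F (Suc i)" if "Suc i < n" for i
    using flag that unfolding group_flag_def by (metis Suc_eq_plus1 less_diff_conv)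
  have le: "?T i j \<le> k \<longleftrightarrow> F i <#> F j \<subseteq> F k" if "i < n" "j < n" "k < n" for i j k
    by (rule group_flag_type_le_iff[OF group_axioms flag that])
  have comm_le: "A <#> B \<subseteq> B <#> A" if "A \<subseteq> carrier G" "B \<subseteq> carrier G" for A B
  proof
    fix x assume "x \<in> A <#> B"
    then obtain a b where "a \<in> A" "b \<in> B" "x = a \<otimes> b" by (auto simp: set_mult_def)
    moreover from this have "x = b \<otimes> a" using that m_comm by blast
    ultimately show "x \<in> B <#> A" unfolding set_mult_def by blast
  qed
  have comm: "F i <#> F j = F j <#> F i" if "i < n" "j < n" for i j
    using comm_le carr that by (simp add: subset_antisym)
  show ?thesis unfolding flag_type_def
  proof (intro conjI allI impI)
    show lt: "?T i j < n" if "i < n" "j < n" for i j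
    proof -
      have "F (n - 1) = carrier G" using flag by (simp add: group_flag_def)
      then have "?T i j \<le> n - 1"
        using le[OF that, of "n - 1"] set_mult_closed[OF carr[OF that(1)] carr[OF that(2)]] that by auto
      then show ?thesis using that by simp
    qed
    show "?T i j = ?T j i" if "i < n" "j < n" for i j
      unfolding group_flag_type_def using comm[OF that] by simp
    show "?T i j \<le> ?T (i + 1) j" if "i < n - 1" "j < n" for i j
    proof -
      have "F i <#> F j \<subseteq> F (i + 1) <#> F j" using strict[of i] that unfolding set_mult_def by force
      also have "\<dots> \<subseteq> F (?T (i + 1) j)" using le[of "i + 1" j "?T (i + 1) j"] lt[of "i + 1" j] that by simp
      finally show ?thesis using le[of i j "?T (i + 1) j"] lt[of "i + 1" j] that by simp
    qed
    show "?T i 0 = i" if "i < n" for i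
    proof -
      have "F i <#> F 0 = F i"
        using flag carr[OF that] by (auto simp: group_flag_def set_mult_def subset_iff)
      then have *: "?T i 0 \<le> k \<longleftrightarrow> F i \<subseteq> F k" if "k < n" for k
        using le[of i 0 k] that \<open>i < n\<close> by simp
      have "\<not> F i \<subseteq> F k" if "k < i" for k
      proof -
        have "finite (F k)" "card (F k) = Suc k" "card (F i) = Suc i"
          using flag that \<open>i < n\<close> by (auto simp: group_flag_def intro: card_ge_0_finite)
        then show ?thesis using card_mono[of "F k" "F i"] that by auto
      qed
      then show ?thesis using *[of i] *[of "?T i 0"] that
        by (metis le_neq_implies_less order_refl order.strict_trans)
    qed
  qed
qed

text \<open>Failure of containment in the preceding set gives a product first occurring at the index
  \<open>group_flag_type G F i j\<close>. Positivity matters because \<open>- 1\<close> truncates at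
  0.\<close>

lemma group_flag_type_witness:
  assumes "group G" and flag: "group_flag n G F" and "i < n" "j < n" and pos: "0 < group_flag_type G F i j"
    and lt: "group_flag_type G F i j < n"
  obtains a b where "a \<in> F i" "b \<in> F j" "a \<otimes>\<^bsub>G\<^esub> b \<in> F (group_flag_type G F i j)"
    "a \<otimes>\<^bsub>G\<^esub> b \<notin> F (group_flag_type G F i j - 1)"
proof -
  let ?t = "group_flag_type G F i j"
  have iff: "?t \<le> k \<longleftrightarrow> F i <#>\<^bsub>G\<^esub> F j \<subseteq> F k" if "k < n" for k
    using group_flag_type_le_iff assms that by blast
  have "?t - 1 < n" "\<not> ?t \<le> ?t - 1" using pos lt by linarith+
  then have "\<not> F i <#>\<^bsub>G\<^esub> F j \<subseteq> F (?t - 1)" using iff by blast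
  moreover have "F i <#>\<^bsub>G\<^esub> F j \<subseteq> F ?t" using iff[OF lt] by blast
  ultimately show thesis using that unfolding set_mult_def by blast
qed

section \<open>The weighted flag of residues modulo 18\<close>

text \<open>Sorted by \<open>residue_weight\<close>, ties in increasing order. The first 3 and the
  first 6 residues form subgroups; the first 12 form two cosets of the subgroup of order 6.\<close>

definition residue_order :: "int list" where
  "residue_order = [0, 6, 12, 3, 9, 15, 1, 10, 4, 7, 13, 16, 2, 11, 5, 8, 14, 17]"

text \<open>The weight of the residue \<open>u\<close> modulo \<open>18\<close> is the length of \<open>u\<close> with respect to generators
  \<open>6, 12\<close> of length \<open>1\<close>, \<open>3, 9, 15\<close> of length \<open>3\<close> and \<open>1, 10\<close> of length \<open>4\<close>.\<close>

definition residue_weight :: "int \<Rightarrow> nat" where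
  "residue_weight u = [0, 4, 8, 3, 5, 9, 1, 5, 9, 3, 4, 8, 1, 5, 9, 3, 5, 9] ! nat u"

definition residue_flag :: "nat \<Rightarrow> int set" where
  "residue_flag i = set (take (Suc i) residue_order)"

lemma distinct_residue_order: "distinct residue_order" and length_residue_order: "length residue_order = 18"
  by (simp_all add: residue_order_def)

lemma set_residue_order: "set residue_order = {0..<18}"
proof (rule card_subset_eq)
  show "set residue_order \<subseteq> {0..<18}" by (simp add: residue_order_def)
  show "card (set residue_order) = card {0..<18::int}"
    using distinct_card[OF distinct_residue_order] by (simp add: length_residue_order)
qed simp

lemma residue_weight_simps:
  "residue_weight 0 = 0" "residue_weight 1 = 4" "residue_weight 2 = 8" "residue_weight 3 = 3"
  "residue_weight 4 = 5" "residue_weight 5 = 9" "residue_weight 6 = 1" "residue_weight 7 = 5"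
  "residue_weight 8 = 9" "residue_weight 9 = 3" "residue_weight 10 = 4" "residue_weight 11 = 8"
  "residue_weight 12 = 1" "residue_weight 13 = 5" "residue_weight 14 = 9" "residue_weight 15 = 3"
  "residue_weight 16 = 5" "residue_weight 17 = 9"
  by (simp_all add: residue_weight_def)

lemma residue_flag_simps:
  "residue_flag 2 = {0, 6, 12}" "residue_flag 5 = {0, 6, 12, 3, 9, 15}"
  "residue_flag 6 = {0, 6, 12, 3, 9, 15, 1}" "residue_flag 7 = {0, 6, 12, 3, 9, 15, 1, 10}"
  "residue_flag 11 = {0, 6, 12, 3, 9, 15, 1, 10, 4, 7, 13, 16}"
  "residue_flag 13 = {0, 6, 12, 3, 9, 15, 1, 10, 4, 7, 13, 16, 2, 11}"
  by (simp_all add: residue_flag_def residue_order_def)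

lemma residue_weight_add_le:
  assumes "u \<in> {0..<18}" "v \<in> {0..<18}"
  shows "residue_weight ((u + v) mod 18) \<le> residue_weight u + residue_weight v"
  using assms unfolding set_residue_order[symmetric] residue_order_def list.set
  by (elim insertE emptyE) (simp_all add: residue_weight_simps)

lemma residue_weight_mono:
  assumes "i \<le> j" "j < 18"
  shows "residue_weight (residue_order ! i) \<le> residue_weight (residue_order ! j)"
proof -
  have "sorted (map residue_weight residue_order)" by (simp add: residue_order_def residue_weight_simps)
  then show ?thesis using assms by (auto simp: sorted_iff_nth_mono length_residue_order)
qed

lemma group_flag_residue_flag: "group_flag 18 (integer_mod_group 18) residue_flag"
  unfolding group_flag_def
proof (intro conjI allI impI)
  show card: "card (residue_flag i) = i + 1" if "i < 18" for i
    using that distinct_card[OF distinct_take[OF distinct_residue_order]]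
    by (simp add: residue_flag_def length_residue_order)
  show "residue_flag i \<subset> residue_flag (i + 1)" if "i < 18 - 1" for i
  proof -
    have "residue_flag i \<subseteq> residue_flag (i + 1)"
      unfolding residue_flag_def by (intro set_take_subset_set_take) simp
    then show ?thesis using card[of i] card[of "i + 1"] that by fastforce
  qed
  show "residue_flag 0 = {\<one>\<^bsub>integer_mod_group 18\<^esub>}" by (simp add: residue_flag_def residue_order_def)
  show "residue_flag (18 - 1) = carrier (integer_mod_group 18)"
    using set_residue_order by (simp add: residue_flag_def carrier_integer_mod_group length_residue_order)
qed

definition residue_flag_type :: "nat \<Rightarrow> nat \<Rightarrow> nat" where
  "residue_flag_type = group_flag_type (integer_mod_group 18) residue_flag"

lemma flag_type_residue_flag_type: "flag_type 18 residue_flag_type"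
  unfolding residue_flag_type_def
  by (rule flag_type_group_flag_type[OF abelian_integer_mod_group group_flag_residue_flag])

lemma realizable_residue_flag_type: "realizable 18 residue_flag_type"
proof -
  have "finite (carrier (integer_mod_group 18))" "order (integer_mod_group 18) = 18"
    by (simp_all add: carrier_integer_mod_group order_def)
  from realizable_group[OF abelian_integer_mod_group this group_flag_residue_flag]
  show ?thesis
    using flag_type_residue_flag_type
    unfolding realizable_def realizable_in_def residue_flag_type_def by blast
qed

lemma residue_flag_type_le:
  assumes "\<And>u v. u \<in> residue_flag i \<Longrightarrow> v \<in> residue_flag j \<Longrightarrow> (u + v) mod 18 \<in> residue_flag k"
  shows "residue_flag_type i j \<le> k"
  unfolding residue_flag_type_def group_flag_type_def
  by (rule Least_le) (use assms in \<open>auto simp: set_mult_def\<close>)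

text \<open>The hypotheses of \<open>realizable_imp_large_entry\<close>. For the last one, 1 and 10
  are the only elements of \<open>residue_flag 7\<close> outside the subgroup of order 6, and their
  sums with each other and with themselves are only 2 and 11 modulo 18.\<close>

lemma residue_flag_type_bounds:
  "residue_flag_type 2 2 \<le> 2" "residue_flag_type 5 5 \<le> 5" "residue_flag_type 5 6 \<le> 11"
  "residue_flag_type 5 11 \<le> 11" "residue_flag_type 2 11 \<le> 11" "residue_flag_type 7 7 \<le> 13"
  by (rule residue_flag_type_le, unfold residue_flag_simps, elim insertE emptyE, simp_all)+

definition weight_point :: "nat \<Rightarrow> real" where
  "weight_point = (\<lambda>k\<in>{1..<18}. real (residue_weight (residue_order ! k)))"

text \<open>Subadditivity is applied to a single sum, one that first occurs at position
  \<open>residue_flag_type i j\<close>; sortedness bounds the weights of its two summands.\<close>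

lemma weight_point_in_polytope: "weight_point \<in> flag_polytope 18 residue_flag_type"
proof -
  have "weight_point (residue_flag_type i j) \<le> weight_point i + weight_point j"
    if ij: "i \<in> {1..<18}" "j \<in> {1..<18}" for i j
  proof -
    let ?t = "residue_flag_type i j"
    have lt: "?t < 18" using flag_type_residue_flag_type ij by (auto simp: flag_type_def)
    \<comment> \<open>There is no coordinate 0; the sum 0 + 6 already leaves
      \<open>residue_flag 0\<close>.\<close>
    have pos: "0 < ?t"
    proof (rule ccontr)
      assume "\<not> 0 < ?t"
      then have "residue_flag i <#>\<^bsub>integer_mod_group 18\<^esub> residue_flag j \<subseteq> residue_flag 0"
        using group_flag_type_le_iff[OF group_integer_mod_group group_flag_residue_flag, of i j 0] ij
        by (simp add: residue_flag_type_def)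
      moreover have "0 \<in> residue_flag i" "6 \<in> residue_flag j"
        using ij by (auto simp: residue_flag_def residue_order_def take_Cons')
      ultimately show False by (auto simp: set_mult_def residue_flag_def residue_order_def)
    qed
    obtain a b where ab: "a \<in> residue_flag i" "b \<in> residue_flag j"
      and c: "(a + b) mod 18 \<in> residue_flag ?t" "(a + b) mod 18 \<notin> residue_flag (?t - 1)"
      using group_flag_type_witness[OF group_integer_mod_group group_flag_residue_flag, of i j] ij pos lt
      by (auto simp: residue_flag_type_def)
    \<comment> \<open>The flag grows by one residue at a time, so the witness sum is exactly the
      residue at position \<open>?t\<close>.\<close>
    have "residue_flag ?t = insert (residue_order ! ?t) (residue_flag (?t - 1))"
      using pos lt take_Suc_conv_app_nth[of ?t residue_order]
      by (simp add: residue_flag_def length_residue_order)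
    then have c: "(a + b) mod 18 = residue_order ! ?t" using c by simp
    have w: "u \<in> {0..<18} \<and> residue_weight u \<le> residue_weight (residue_order ! l)"
      if "u \<in> residue_flag l" "l < 18" for u l
    proof -
      from that(1) obtain m where "m \<le> l" "u = residue_order ! m"
        by (auto simp: residue_flag_def in_set_conv_nth less_Suc_eq_le)
      then show ?thesis using residue_weight_mono[of m l] that nth_mem[of m residue_order]
        by (simp add: length_residue_order set_residue_order)
    qed
    have "residue_weight (residue_order ! ?t) \<le> residue_weight a + residue_weight b"
      using residue_weight_add_le[of a b] w[OF ab(1)] w[OF ab(2)] ij c by auto
    also have "\<dots> \<le> residue_weight (residue_order ! i) + residue_weight (residue_order ! j)"
      using w[OF ab(1)] w[OF ab(2)] ij by (intro add_mono) auto
    finally show ?thesis using ij pos lt by (simp add: weight_point_def flip: of_nat_add)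
  qed
  then show ?thesis
    using residue_weight_mono by (auto simp: flag_polytope_def weight_point_def)
qed

section \<open>Flags of products of three cyclic groups\<close>

lemma mixed_radix_digit_triple:
  "mixed_radix_digit [a, b, c] m 0 = m mod a"
  "mixed_radix_digit [a, b, c] m (Suc 0) = m div a mod b"
  "mixed_radix_digit [a, b, c] m 2 = m div (a * b) mod c"
  by (simp_all add: mixed_radix_digit_def numeral_2_eq_2)

lemma tuple_element_eq_iff:
  "tuple_element ns m = tuple_element ns m' \<longleftrightarrow>
    (\<forall>s<length ns. mixed_radix_digit ns m s mod ns ! s = mixed_radix_digit ns m' s mod ns ! s)"
proof -
  have "int (mixed_radix_digit ns m s) mod int (ns ! s) = int (mixed_radix_digit ns m' s) mod int (ns ! s) \<longleftrightarrow>
      mixed_radix_digit ns m s mod ns ! s = mixed_radix_digit ns m' s mod ns ! s" for s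
    by (simp flip: of_nat_mod)
  then show ?thesis by (auto simp: tuple_element_def fun_eq_iff restrict_def)
qed

lemma mult_tuple_element:
  "tuple_element ns i \<otimes>\<^bsub>tuple_group ns\<^esub> tuple_element ns j = tuple_element ns m \<longleftrightarrow>
    (\<forall>s<length ns. (mixed_radix_digit ns i s + mixed_radix_digit ns j s) mod ns ! s =
      mixed_radix_digit ns m s mod ns ! s)"
proof -
  have "(int (mixed_radix_digit ns i s) + int (mixed_radix_digit ns j s)) mod int (ns ! s) =
        int (mixed_radix_digit ns m s) mod int (ns ! s) \<longleftrightarrow>
      (mixed_radix_digit ns i s + mixed_radix_digit ns j s) mod ns ! s =
        mixed_radix_digit ns m s mod ns ! s" for s
    by (simp flip: of_nat_mod of_nat_add)
  then show ?thesis
    by (auto simp: tuple_element_def tuple_group_def fun_eq_iff restrict_def mod_add_eq)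
qed

lemma all_less_3: "(\<forall>s<Suc (Suc (Suc 0)). P s) \<longleftrightarrow> P 0 \<and> P (Suc 0) \<and> P 2"
  by (auto simp: All_less_Suc numeral_2_eq_2)

lemma inj_on_tuple_element:
  assumes "0 < a" "0 < b" "0 < c"
  shows "inj_on (tuple_element [a, b, c]) {..<a * b * c}"
proof (rule inj_onI)
  fix m m' assume m: "m \<in> {..<a * b * c}" "m' \<in> {..<a * b * c}"
    and eq: "tuple_element [a, b, c] m = tuple_element [a, b, c] m'"
  have decomp: "k = k mod a + a * (k div a mod b + b * (k div (a * b) mod c))" if "k < a * b * c" for k
  proof -
    \<comment> \<open>Reducing the top digit modulo \<open>c\<close> changes nothing, so the three
      digits determine \<open>k\<close>.\<close>
    have "k div (a * b) < c" using that by (simp add: less_mult_imp_div_less mult.commute)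
    then have "k div (a * b) mod c = k div a div b" by (simp add: div_mult2_eq)
    then show ?thesis by (metis mod_mult_div_eq mult.commute)
  qed
  have "m mod a = m' mod a" "m div a mod b = m' div a mod b" "m div (a * b) mod c = m' div (a * b) mod c"
    using eq by (simp_all add: tuple_element_eq_iff all_less_3 mixed_radix_digit_triple)
  then show "m = m'" using decomp[of m] decomp[of m'] m by simp
qed

lemma tuple_element_image:
  assumes "0 < a" "0 < b" "0 < c"
  shows "tuple_element [a, b, c] ` {..<a * b * c} = carrier (tuple_group [a, b, c])"
proof (rule card_subset_eq)
  have carr: "carrier (tuple_group [a, b, c]) = (\<Pi>\<^sub>E s\<in>{..<length [a, b, c]}. {0..<int ([a, b, c] ! s)})"
    unfolding tuple_group_def carrier_product_group
    by (rule PiE_cong) (use assms in \<open>auto simp: carrier_integer_mod_group less_Suc_eq\<close>)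
  show "finite (carrier (tuple_group [a, b, c]))" unfolding carr by (intro finite_PiE) auto
  have pos: "0 < [a, b, c] ! s" if "s < length [a, b, c]" for s
    using assms that by (auto simp: less_Suc_eq)
  then show "tuple_element [a, b, c] ` {..<a * b * c} \<subseteq> carrier (tuple_group [a, b, c])"
    unfolding carr by (auto simp: tuple_element_def)
  have "card (carrier (tuple_group [a, b, c])) = a * b * c"
    unfolding carr by (simp add: card_PiE lessThan_Suc)
  then show "card (tuple_element [a, b, c] ` {..<a * b * c}) = card (carrier (tuple_group [a, b, c]))"
    using card_image[OF inj_on_tuple_element[OF assms]] by simp
qed

text \<open>The digit conditions say that elements \<open>i\<close> and \<open>j\<close> multiply to
  element \<open>m\<close>, which by injectivity lies in no set of the flag before index
  \<open>m\<close>.\<close>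

lemma tuple_flag_type_bounds:
  assumes pos: "0 < a" "0 < b" "0 < c" and n: "n = a * b * c" and "i < n" "j < n" "m < n"
    and digits: "(i mod a + j mod a) mod a = m mod a" "(i div a mod b + j div a mod b) mod b = m div a mod b"
      "(i div (a * b) mod c + j div (a * b) mod c) mod c = m div (a * b) mod c"
  shows "m \<le> tuple_flag_type [a, b, c] i j" and "tuple_flag_type [a, b, c] i j < n"
proof -
  let ?ns = "[a, b, c]" and ?t = "tuple_flag_type [a, b, c] i j"
  have img: "tuple_flag ?ns (n - 1) = carrier (tuple_group ?ns)"
  proof -
    have "{..n - 1} = {..<n}" using \<open>i < n\<close> by auto
    then show ?thesis unfolding tuple_flag_def using tuple_element_image[OF pos] n by simp
  qed
  have grp: "group (tuple_group ?ns)" unfolding tuple_group_def by (rule product_group) simp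
  have sub: "tuple_flag ?ns k \<subseteq> carrier (tuple_group ?ns)" if "k < n" for k
    unfolding img[symmetric] tuple_flag_def using that by (intro image_mono) auto
  have all: "tuple_flag ?ns i <#>\<^bsub>tuple_group ?ns\<^esub> tuple_flag ?ns j \<subseteq> tuple_flag ?ns (n - 1)"
    unfolding img
    by (rule monoid.set_mult_closed[OF group.is_monoid[OF grp] sub[OF \<open>i < n\<close>] sub[OF \<open>j < n\<close>]])
  have "?t \<le> n - 1"
    unfolding tuple_flag_type_def group_flag_type_def using all by (rule Least_le)
  then show t: "?t < n" using \<open>i < n\<close> by simp
  have "tuple_flag ?ns i <#>\<^bsub>tuple_group ?ns\<^esub> tuple_flag ?ns j \<subseteq> tuple_flag ?ns ?t"
    unfolding tuple_flag_type_def group_flag_type_def using all by (rule LeastI)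
  moreover have "tuple_element ?ns i \<otimes>\<^bsub>tuple_group ?ns\<^esub> tuple_element ?ns j = tuple_element ?ns m"
    using digits by (simp add: mult_tuple_element all_less_3 mixed_radix_digit_triple)
  ultimately have "tuple_element ?ns m \<in> tuple_flag ?ns ?t"
    unfolding set_mult_def tuple_flag_def by force
  then obtain k where k: "k \<le> ?t" "tuple_element ?ns m = tuple_element ?ns k"
    by (auto simp: tuple_flag_def)
  then have "m = k" using inj_onD[OF inj_on_tuple_element[OF pos] k(2)] \<open>m < n\<close> t n by simp
  then show "m \<le> ?t" using k by simp
qed

text \<open>The weights are sorted, so the violation at \<open>m\<close> persists at the possibly
  larger index \<open>tuple_flag_type [a, b, c] i j\<close>.\<close>

lemma weight_point_notin_tuple_polytope:
  assumes "0 < a" "0 < b" "0 < c" "18 = a * b * c" and "i \<in> {1..<18}" "j \<in> {1..<18}" "m \<in> {1..<18}"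
    and "(i mod a + j mod a) mod a = m mod a" "(i div a mod b + j div a mod b) mod b = m div a mod b"
      "(i div (a * b) mod c + j div (a * b) mod c) mod c = m div (a * b) mod c"
    and less: "residue_weight (residue_order ! i) + residue_weight (residue_order ! j) <
      residue_weight (residue_order ! m)"
  shows "weight_point \<notin> flag_polytope 18 (tuple_flag_type [a, b, c])"
proof
  let ?t = "tuple_flag_type [a, b, c] i j"
  assume x: "weight_point \<in> flag_polytope 18 (tuple_flag_type [a, b, c])"
  have t: "m \<le> ?t" "?t < 18" using tuple_flag_type_bounds[OF assms(1-4) _ _ _ assms(8-10)] assms(5-7) by auto
  have "weight_point ?t \<le> weight_point i + weight_point j" using x assms(5,6) by (auto simp: flag_polytope_def)
  moreover have "weight_point m \<le> weight_point ?t"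
    using residue_weight_mono[OF t] t assms(7) by (simp add: weight_point_def)
  ultimately have "real (residue_weight (residue_order ! m)) \<le>
      real (residue_weight (residue_order ! i)) + real (residue_weight (residue_order ! j))"
    using assms(5-7) by (simp add: weight_point_def)
  then show False using less by linarith
qed

section \<open>The weight point and the corner for a minimal type below
  \<open>residue_flag_type\<close>\<close>

lemma minimal_below_residue_flag_type:
  assumes "minimal_flag_type 18 T" and "flag_type_le 18 T residue_flag_type"
  shows "\<exists>T. minimal_flag_type 18 T \<and>
    flag_polytope 18 T -
      (flag_polytope 18 (tuple_flag_type [2, 3, 3]) \<union>
       flag_polytope 18 (tuple_flag_type [3, 2, 3]) \<union>
       flag_polytope 18 (tuple_flag_type [3, 3, 2])) \<noteq> {} \<and>
    (\<exists>i j. corner 18 T i j \<and> T i j > i + j)"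
proof -
  have real: "realizable 18 T" and ft: "flag_type 18 T"
    using assms(1) by (auto simp: minimal_flag_type_def realizable_def realizable_in_def)
  have "weight_point \<in> flag_polytope 18 T"
    using flag_polytope_antimono[OF assms(2) ft flag_type_residue_flag_type] weight_point_in_polytope by blast
  \<comment> \<open>In all three cases the digits of \<open>i\<close> and \<open>j\<close> add
    without carry, so \<open>m = i + j\<close>. The violations are 1 + 1 < 3, 4 + 4 < 9 and 3 + 5 <
    9.\<close>
  moreover have "weight_point \<notin> flag_polytope 18 (tuple_flag_type [2, 3, 3])"
    by (rule weight_point_notin_tuple_polytope[where i = 2 and j = 2 and m = 4])
      (simp_all add: residue_weight_def residue_order_def)
  moreover have "weight_point \<notin> flag_polytope 18 (tuple_flag_type [3, 2, 3])"
    by (rule weight_point_notin_tuple_polytope[where i = 7 and j = 7 and m = 14])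
      (simp_all add: residue_weight_def residue_order_def)
  moreover have "weight_point \<notin> flag_polytope 18 (tuple_flag_type [3, 3, 2])"
    by (rule weight_point_notin_tuple_polytope[where i = 3 and j = 11 and m = 14])
      (simp_all add: residue_weight_def residue_order_def)
  moreover have "T i j \<le> k" if "residue_flag_type i j \<le> k" "i < 18" "j < 18" for i j k
    using assms(2) that by (meson flag_type_le_def order_trans)
  then have "T 1 6 > 7"
    using realizable_imp_large_entry[OF real] residue_flag_type_bounds by simp
  then have "\<exists>i j. corner 18 T i j \<and> T i j > i + j"
    by (intro corner_below_exceeding_entry[OF ft, of 1 6]) simp_all
  ultimately show ?thesis using assms(1) by blast
qed

theorem theorem1p25:
  shows "\<exists>T. minimal_flag_type 18 T \<and>
    flag_polytope 18 T -
      (flag_polytope 18 (tuple_flag_type [2, 3, 3]) \<union>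
       flag_polytope 18 (tuple_flag_type [3, 2, 3]) \<union>
       flag_polytope 18 (tuple_flag_type [3, 3, 2])) \<noteq> {} \<and>
    (\<exists>i j. corner 18 T i j \<and> T i j > i + j)"
  by (rule exists_minimal_flag_type_le[OF realizable_residue_flag_type minimal_below_residue_flag_type])

end
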